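(* Fix a constant $\varepsilon>0$, let $d=6\lceil 1/\varepsilon\rceil$, and consider a BTTP instance with leagues $X,Y$ of size $n\ge 108d^3$. Let $m=2\lfloor n/(6d)\rfloor-1$ and $n_\varepsilon=3md$. Let $X_\varepsilon\subseteq X$ consist of $n_\varepsilon$ teams $x$ with the largest values of $\delta_Y(x)$, and $Y_\varepsilon\subseteq Y$ of $n_\varepsilon$ teams $y$ with the largest values of $\delta_X(y)$. Then for any 3-path packing $\mathcal{P}_{X_\varepsilon}$ of the complete graph on $X_\varepsilon$ and any 3-path packing $\mathcal{P}_{Y_\varepsilon}$ of the complete graph on $Y_\varepsilon$, there is a randomized $O(n^2)$-time algorithm that outputs a feasible schedule whose expected weight is at most \[\delta_{Y_\varepsilon}(\mathcal{P}_{X_\varepsilon})+n_\varepsilon w(\mathcal{P}_{X_\varepsilon})+\delta_{X_\varepsilon}(\mathcal{P}_{Y_\varepsilon})+n_\varepsilon w(\mathcal{P}_{Y_\varepsilon})+\varepsilon\cdot\mathrm{OPT}.\]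
   Context: BTTP: an instance consists of two disjoint sets (leagues) $X$ and $Y$ of $n$ teams each and a weight function $w$ on pairs of teams that is non-negative, symmetric and satisfies the triangle inequality. A feasible schedule is a double round-robin bipartite tournament on $2n$ consecutive days: every $x\in X$ and $y\in Y$ play exactly twice, once at each one's home; every team plays exactly one game per day; no pair plays on two consecutive days; no team plays more than 3 consecutive home or more than 3 consecutive away games. Teams start at home, travel directly between consecutive game venues, and return home after the last day; the weight of a schedule is the total distance traveled by all teams, and $\mathrm{OPT}$ is the minimum weight of a feasible schedule. Notation: $\delta_{Y'}(x)=\sum_{y\in Y'}w(x,y)$ for $Y'\subseteq Y$ (symmetrically for $X'\subseteq X$). A 3-path packing of a complete graph is a set of vertex-disjoint simple paths on 3 vertices covering all vertices; $w(\mathcal{P})$ is the total weight of its edges; for a 3-path packing $\mathcal{P}$ of the graph on $X_\varepsilon$, $\delta_{Y_\varepsilon}(\mathcal{P})=\sum_{xx'x''\in\mathcal{P}}(\delta_{Y_\varepsilon}(x)+\delta_{Y_\varepsilon}(x''))$ (sum over terminals), and symmetrically $\delta_{X_\varepsilon}(\mathcal{P})$ for a packing of $Y_\varepsilon$. *)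

theory Defs
  imports "HOL-Probability.Probability"
begin

section \<open>Bipartite tournaments\<close>

text \<open>Since \<open>w\<close> is a total function whereas the weights live on pairs of distinct teams, the
  diagonal is fixed to be zero: staying at a venue costs nothing.\<close>

definition bttp_instance :: "nat \<Rightarrow> 'a set \<Rightarrow> 'a set \<Rightarrow> ('a \<Rightarrow> 'a \<Rightarrow> real) \<Rightarrow> bool" where
  "bttp_instance n X Y w \<longleftrightarrow>
     finite X \<and> finite Y \<and> card X = n \<and> card Y = n \<and> X \<inter> Y = {} \<and>
     (\<forall>u\<in>X \<union> Y. w u u = 0) \<and>
     (\<forall>u\<in>X \<union> Y. \<forall>v\<in>X \<union> Y. 0 \<le> w u v \<and> w u v = w v u) \<and>
     (\<forall>u\<in>X \<union> Y. \<forall>v\<in>X \<union> Y. \<forall>z\<in>X \<union> Y. w u z \<le> w u v + w v z)"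

text \<open>A schedule assigns to each day \<open>0, \<dots>, 2 * n - 1\<close> its set of games \<open>(home team, away team)\<close>;
  the values on later days are irrelevant.\<close>

type_synonym 'a schedule = "nat \<Rightarrow> ('a \<times> 'a) set"

definition plays_home :: "'a schedule \<Rightarrow> nat \<Rightarrow> 'a \<Rightarrow> bool" where
  "plays_home G t u \<longleftrightarrow> (\<exists>a. (u, a) \<in> G t)"

definition plays_away :: "'a schedule \<Rightarrow> nat \<Rightarrow> 'a \<Rightarrow> bool" where
  "plays_away G t u \<longleftrightarrow> (\<exists>h. (h, u) \<in> G t)"

definition feasible :: "nat \<Rightarrow> 'a set \<Rightarrow> 'a set \<Rightarrow> 'a schedule \<Rightarrow> bool" where
  "feasible n X Y G \<longleftrightarrow>
     (\<forall>t<2*n. G t \<subseteq> X \<times> Y \<union> Y \<times> X) \<and>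
     (\<forall>x\<in>X. \<forall>y\<in>Y. (\<exists>!t. t < 2*n \<and> (x, y) \<in> G t) \<and> (\<exists>!t. t < 2*n \<and> (y, x) \<in> G t)) \<and>
     (\<forall>t<2*n. \<forall>u\<in>X \<union> Y. \<exists>!g. g \<in> G t \<and> (u = fst g \<or> u = snd g)) \<and>
     (\<forall>t. t + 1 < 2*n \<longrightarrow> (\<forall>(h, a)\<in>G t. (h, a) \<notin> G (t + 1) \<and> (a, h) \<notin> G (t + 1))) \<and>
     (\<forall>u\<in>X \<union> Y. \<forall>t. t + 3 < 2*n \<longrightarrow>
        \<not> (\<forall>i\<le>3. plays_home G (t + i) u) \<and> \<not> (\<forall>i\<le>3. plays_away G (t + i) u))"

definition venue :: "'a schedule \<Rightarrow> nat \<Rightarrow> 'a \<Rightarrow> 'a" where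
  "venue G t u = (if plays_home G t u then u else (THE h. (h, u) \<in> G t))"

definition travel :: "nat \<Rightarrow> ('a \<Rightarrow> 'a \<Rightarrow> real) \<Rightarrow> 'a schedule \<Rightarrow> 'a \<Rightarrow> real" where
  "travel n w G u =
     w u (venue G 0 u) + (\<Sum>t<2*n - 1. w (venue G t u) (venue G (t + 1) u))
       + w (venue G (2*n - 1) u) u"

definition schedule_weight ::
    "nat \<Rightarrow> 'a set \<Rightarrow> 'a set \<Rightarrow> ('a \<Rightarrow> 'a \<Rightarrow> real) \<Rightarrow> 'a schedule \<Rightarrow> real" where
  "schedule_weight n X Y w G = (\<Sum>u\<in>X \<union> Y. travel n w G u)"

text \<open>The infimum is a minimum: only finitely many values occur, as the days
  before \<open>2 * n\<close> admit finitely many sets of games.\<close>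

definition OPT :: "nat \<Rightarrow> 'a set \<Rightarrow> 'a set \<Rightarrow> ('a \<Rightarrow> 'a \<Rightarrow> real) \<Rightarrow> real" where
  "OPT n X Y w = (INF G\<in>{G. feasible n X Y G}. schedule_weight n X Y w G)"


section \<open>Degrees and 3-path packings\<close>

definition delta :: "('a \<Rightarrow> 'a \<Rightarrow> real) \<Rightarrow> 'a set \<Rightarrow> 'a \<Rightarrow> real" where
  "delta w Z u = (\<Sum>z\<in>Z. w u z)"

definition largest_teams ::
    "nat \<Rightarrow> ('a \<Rightarrow> 'a \<Rightarrow> real) \<Rightarrow> 'a set \<Rightarrow> 'a set \<Rightarrow> 'a set \<Rightarrow> bool" where
  "largest_teams k w Z X S \<longleftrightarrow>
     S \<subseteq> X \<and> card S = k \<and> (\<forall>u\<in>S. \<forall>v\<in>X - S. delta w Z v \<le> delta w Z u)"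

text \<open>A triple \<open>(a, b, c)\<close> stands for the path with edges \<open>ab\<close>, \<open>bc\<close> and terminals \<open>a\<close>, \<open>c\<close>.
  Disjointness of distinct triples ensures that each undirected path of a packing is
  listed in only one of its two orientations.\<close>

fun path_verts :: "'a \<times> 'a \<times> 'a \<Rightarrow> 'a set" where
  "path_verts (a, b, c) = {a, b, c}"

definition three_path_packing :: "'a set \<Rightarrow> ('a \<times> 'a \<times> 'a) set \<Rightarrow> bool" where
  "three_path_packing V P \<longleftrightarrow>
     (\<forall>(a, b, c)\<in>P. a \<noteq> b \<and> b \<noteq> c \<and> a \<noteq> c) \<and>
     (\<forall>p\<in>P. \<forall>q\<in>P. p \<noteq> q \<longrightarrow> path_verts p \<inter> path_verts q = {}) \<and>
     (\<Union>p\<in>P. path_verts p) = V"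

definition packing_weight :: "('a \<Rightarrow> 'a \<Rightarrow> real) \<Rightarrow> ('a \<times> 'a \<times> 'a) set \<Rightarrow> real" where
  "packing_weight w P = (\<Sum>(a, b, c)\<in>P. w a b + w b c)"

definition delta_packing ::
    "('a \<Rightarrow> 'a \<Rightarrow> real) \<Rightarrow> 'a set \<Rightarrow> ('a \<times> 'a \<times> 'a) set \<Rightarrow> real" where
  "delta_packing w Z P = (\<Sum>(a, b, c)\<in>P. delta w Z a + delta w Z c)"


section \<open>Randomized word RAM programs\<close>

text \<open>Programs operate on integer arrays and on real arrays, both initially zero except for the
  input. Scalars are cells 0 of arrays. Reals can only be copied, added, subtracted and compared,
  and no real constants are available; in particular a real cannot be turned into an integer.\<close>

type_synonym name = string

record memory =
  ints :: "name \<Rightarrow> nat \<Rightarrow> nat"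
  reals :: "name \<Rightarrow> nat \<Rightarrow> real"

datatype nexp =
    Const nat | Load name nexp
  | Plus nexp nexp | Minus nexp nexp | Times nexp nexp | Div nexp nexp | Mod nexp nexp

datatype rexp = RLoad name nexp | RPlus rexp rexp | RMinus rexp rexp

datatype bexp = Less nexp nexp | RLess rexp rexp | Not bexp | And bexp bexp

primrec nval :: "nexp \<Rightarrow> memory \<Rightarrow> nat" where
  "nval (Const k) s = k"
| "nval (Load a i) s = ints s a (nval i s)"
| "nval (Plus e f) s = nval e s + nval f s"
| "nval (Minus e f) s = nval e s - nval f s"
| "nval (Times e f) s = nval e s * nval f s"
| "nval (Div e f) s = nval e s div nval f s"
| "nval (Mod e f) s = nval e s mod nval f s"

primrec rval :: "rexp \<Rightarrow> memory \<Rightarrow> real" where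
  "rval (RLoad a i) s = reals s a (nval i s)"
| "rval (RPlus e f) s = rval e s + rval f s"
| "rval (RMinus e f) s = rval e s - rval f s"

primrec bval :: "bexp \<Rightarrow> memory \<Rightarrow> bool" where
  "bval (Less e f) s \<longleftrightarrow> nval e s < nval f s"
| "bval (RLess e f) s \<longleftrightarrow> rval e s < rval f s"
| "bval (Not b) s \<longleftrightarrow> \<not> bval b s"
| "bval (And b c) s \<longleftrightarrow> bval b s \<and> bval c s"

text \<open>\<open>Store a i e\<close> and \<open>RStore a i e\<close> assign to cell \<open>i\<close> of array \<open>a\<close>, and \<open>Rand a i e\<close> fills it
  with a uniformly random integer below the value of \<open>e\<close>.\<close>

datatype com =
    Skip
  | Store name nexp nexp
  | RStore name nexp rexp
  | Rand name nexp nexp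
  | Seq com com
  | If bexp com com
  | While bexp com

definition store :: "name \<Rightarrow> nat \<Rightarrow> nat \<Rightarrow> memory \<Rightarrow> memory" where
  "store a i v s = s\<lparr>ints := (ints s)(a := (ints s a)(i := v))\<rparr>"

definition rstore :: "name \<Rightarrow> nat \<Rightarrow> real \<Rightarrow> memory \<Rightarrow> memory" where
  "rstore a i v s = s\<lparr>reals := (reals s)(a := (reals s a)(i := v))\<rparr>"

text \<open>One unit of time. An instruction that would store an integer not below the word bound \<open>W\<close>, use
  such an address for storing, or draw from an empty range, is stuck: it loops on itself, so the
  program never halts. Expressions have constant size, hence for polynomially bounded \<open>W\<close> all
  values computed have a logarithmic number of bits.\<close>

primrec step :: "nat \<Rightarrow> com \<Rightarrow> memory \<Rightarrow> (com \<times> memory) pmf" where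
  "step W Skip s = return_pmf (Skip, s)"
| "step W (Store a i e) s = return_pmf
     (if nval i s < W \<and> nval e s < W then (Skip, store a (nval i s) (nval e s) s)
      else (Store a i e, s))"
| "step W (RStore a i e) s = return_pmf
     (if nval i s < W then (Skip, rstore a (nval i s) (rval e s) s) else (RStore a i e, s))"
| "step W (Rand a i e) s =
     (if nval i s < W \<and> 0 < nval e s \<and> nval e s \<le> W
      then map_pmf (\<lambda>v. (Skip, store a (nval i s) v s)) (pmf_of_set {..<nval e s})
      else return_pmf (Rand a i e, s))"
| "step W (Seq c1 c2) s =
     (if c1 = Skip then return_pmf (c2, s)
      else map_pmf (\<lambda>(c', s'). (Seq c' c2, s')) (step W c1 s))"
| "step W (If b c1 c2) s = return_pmf (if bval b s then c1 else c2, s)"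
| "step W (While b c) s = return_pmf (if bval b s then Seq c (While b c) else Skip, s)"

primrec run :: "nat \<Rightarrow> nat \<Rightarrow> com \<Rightarrow> memory \<Rightarrow> (com \<times> memory) pmf" where
  "run W 0 c s = return_pmf (c, s)"
| "run W (Suc T) c s = bind_pmf (run W T c s) (\<lambda>(c', s'). step W c' s')"


section \<open>Input and output encodings\<close>

text \<open>Teams are presented to a program by their numbers: \<open>team\<close> enumerates \<open>X\<close> on \<open>{..<n}\<close> and \<open>Y\<close> on
  \<open>{n..<2 * n}\<close>.\<close>

definition team_numbering :: "nat \<Rightarrow> 'a set \<Rightarrow> 'a set \<Rightarrow> (nat \<Rightarrow> 'a) \<Rightarrow> bool" where
  "team_numbering n X Y team \<longleftrightarrow> bij_betw team {..<n} X \<and> bij_betw team {n..<2*n} Y"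

definition encode_paths ::
    "nat \<Rightarrow> (nat \<Rightarrow> 'a) \<Rightarrow> ('a \<times> 'a \<times> 'a) list \<Rightarrow> nat \<Rightarrow> nat" where
  "encode_paths n team ps i =
     (let us = concat (map (\<lambda>(a, b, c). [a, b, c]) ps)
      in if i < length us then the_inv_into {..<2*n} team (us ! i) else 0)"

definition input_memory ::
    "nat \<Rightarrow> ('a \<Rightarrow> 'a \<Rightarrow> real) \<Rightarrow> (nat \<Rightarrow> 'a) \<Rightarrow>
     ('a \<times> 'a \<times> 'a) list \<Rightarrow> ('a \<times> 'a \<times> 'a) list \<Rightarrow> memory" where
  "input_memory n w team PX PY =
     \<lparr>ints = (\<lambda>_ _. 0)
        (''n'' := (\<lambda>_. 0)(0 := n),
         ''px'' := encode_paths n team PX,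
         ''py'' := encode_paths n team PY),
      reals = (\<lambda>_ _. 0)
        (''w'' := (\<lambda>i. if i < (2*n)^2 then w (team (i div (2*n))) (team (i mod (2*n))) else 0))\<rparr>"

text \<open>The \<open>k\<close>-th game of day \<open>t\<close> is read off cells \<open>t * n + k\<close> of two arrays of team numbers.\<close>

definition output_schedule :: "nat \<Rightarrow> (nat \<Rightarrow> 'a) \<Rightarrow> memory \<Rightarrow> 'a schedule" where
  "output_schedule n team s t =
     {(team (ints s ''home'' (t*n + k)), team (ints s ''away'' (t*n + k))) | k. k < n}"

end

theory Submission
  imports Defs
begin

text \<open>Put the teams of each league in a row: first the paths, one after the other, then the remaining
  teams in groups of one or two, so that the number \<open>P\<close> of groups (paths included) is odd. On day \<open>t\<close> let
  the \<open>i\<close>-th team of \<open>X\<close> meet the \<open>j\<close>-th team of \<open>Y\<close> with \<open>i + j \<equiv> t\<close> modulo \<open>n\<close>, so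
  that every team meets the row of opponents in cyclic order, and let the sum of the two group
  numbers, the opponents' groups being counted on through all rounds of the row, decide by its
  parity who is at home. Then every team switches between home and away exactly when it passes to
  the next group: there are at most three home or away games in a row, every trip into a path visits it from
  end to end, and since \<open>P\<close> is odd, the second meeting of a pair takes place at the other venue.

  Trips are interrupted only on the first and the last day. A random cyclic shift of the paths
  of \<open>X\<close> spreads the games of these two days evenly over all pairs of teams on paths, so they cost at
  most a fraction of order \<open>1 / M\<close> of the total weight, where \<open>M\<close> is the number of paths. The teams outside
  the paths have the smallest degrees, hence they contribute only a small fraction as well.
  Finally the optimum is at least \<open>2 / 3\<close> of the total weight, as a trip has at most three games.\<close>


section \<open>The cyclic schedule\<close>

text \<open>\<open>g i\<close> numbers the group at position \<open>i\<close> of the row.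
  \<open>g_add_3\<close> limits a group to three teams, which becomes the limit on home and away
  games in a row.\<close>

locale grouping =
  fixes n P :: nat and g :: "nat \<Rightarrow> nat"
  assumes n_ge_2: "2 \<le> n"
    and odd_P: "odd P"
    and g_0: "g 0 = 0"
    and g_last: "Suc (g (n - 1)) = P"
    and g_Suc: "\<And>i. Suc i < n \<Longrightarrow> g (Suc i) = g i \<or> g (Suc i) = Suc (g i)"
    and g_add_3: "\<And>i. i + 3 < n \<Longrightarrow> g i < g (i + 3)"
begin

text \<open>\<open>J\<close> is a position in the row repeated without end. Each finished round adds
  \<open>P\<close>, so the group count never falls back.\<close>

definition level :: "nat \<Rightarrow> nat" where
  "level J = g (J mod n) + P * (J div n)"

text \<open>The added \<open>n\<close> keeps the truncated subtraction exact for
  \<open>i < n\<close>.\<close>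

definition opp :: "nat \<Rightarrow> nat \<Rightarrow> nat" where
  "opp t i = (t + n - i) mod n"

definition rank :: "nat \<Rightarrow> nat \<Rightarrow> nat" where
  "rank t i = g i + level (t + n - i)"

text \<open>The bit \<open>b\<close> flips every venue. With it, exchanging the two leagues yields a
  schedule of the same form.\<close>

definition game :: "nat \<Rightarrow> (nat \<Rightarrow> 'a) \<Rightarrow> (nat \<Rightarrow> 'a) \<Rightarrow> nat \<Rightarrow> nat \<Rightarrow> 'a \<times> 'a" where
  "game b A B t i =
     (if even (rank t i + b) then (A i, B (opp t i)) else (B (opp t i), A i))"

definition cyclic_schedule :: "nat \<Rightarrow> (nat \<Rightarrow> 'a) \<Rightarrow> (nat \<Rightarrow> 'a) \<Rightarrow> 'a schedule" where
  "cyclic_schedule b A B t = game b A B t ` {..<n}"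

lemma n_pos: "0 < n"
  using n_ge_2 by simp

text \<open>At the end of a round \<open>g\<close> drops from \<open>P - 1\<close> to 0 while the
  round count adds \<open>P\<close>.\<close>

lemma level_Suc_wrap:
  assumes "Suc J mod n = 0"
  shows "level (Suc J) = Suc (level J)"
proof -
  have "Suc (J mod n) = n"
    using assms n_pos by (auto simp: mod_Suc split: if_splits)
  then have "J mod n = n - 1" and "Suc J div n = Suc (J div n)"
    using assms by (auto simp: div_Suc)
  then show ?thesis
    using assms g_0 g_last by (simp add: level_def)
qed

lemma level_Suc: "level (Suc J) = level J \<or> level (Suc J) = Suc (level J)"
proof (cases "Suc J mod n = 0")
  case False
  then have "Suc J mod n = Suc (J mod n)" and "Suc J div n = J div n"
    by (auto simp: mod_Suc div_Suc split: if_splits)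
  moreover have "Suc (J mod n) < n"
    using calculation n_pos by (metis mod_less_divisor)
  ultimately show ?thesis
    using g_Suc[of "J mod n"] by (auto simp: level_def)
qed (simp add: level_Suc_wrap)

lemma level_le_Suc: "level J \<le> level (Suc J)"
  using level_Suc[of J] by auto

text \<open>Inside a round this is \<open>g_add_3\<close>; otherwise one of the three steps crosses
  the end of the row, where the level always rises.\<close>

lemma level_add_3: "level J < level (J + 3)"
proof (cases "J mod n + 3 < n")
  case True
  have "J + 3 = (J mod n + 3) + n * (J div n)"
    by simp
  then have "(J + 3) mod n = J mod n + 3" "(J + 3) div n = J div n"
    using True n_pos by (simp_all only: mod_mult_self2 div_mult_self2 mod_less div_less)
  then show ?thesis
    using g_add_3[OF True] by (simp add: level_def)
next
  case False
  have "Suc J mod n = 0 \<or> Suc (Suc J) mod n = 0 \<or> Suc (Suc (Suc J)) mod n = 0"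
    using False mod_less_divisor[OF n_pos, of J] by (auto simp: mod_Suc)
  then have "level J < level (Suc (Suc (Suc J)))"
    using level_Suc_wrap[of J] level_Suc_wrap[of "Suc J"] level_Suc_wrap[of "Suc (Suc J)"]
      level_le_Suc[of J] level_le_Suc[of "Suc J"] level_le_Suc[of "Suc (Suc J)"] by linarith
  then show ?thesis
    by (simp add: numeral_3_eq_3)
qed

text \<open>Steps of size zero or one that never change the parity are all zero, which contradicts
  the strict growth over three steps.\<close>

lemma level_parity_changes:
  "\<exists>k\<le>3. even (level (J + k)) \<noteq> even (level J)"
proof (rule ccontr)
  assume "\<not> ?thesis"
  then have "even (level (J + k)) = even (level J)" if "k \<le> 3" for k
    using that by blast
  note parity = this[of 1] this[of 2] this[of 3]
  have "level (J + 1) = level J \<or> level (J + 1) = Suc (level J)"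
    "level (J + 2) = level (J + 1) \<or> level (J + 2) = Suc (level (J + 1))"
    "level (J + 3) = level (J + 2) \<or> level (J + 3) = Suc (level (J + 2))"
    using level_Suc[of J] level_Suc[of "J + 1"] level_Suc[of "J + 2"]
    by (simp_all add: eval_nat_numeral)
  then show False
    using parity level_add_3[of J] by auto
qed

lemma level_parity_alternates:
  assumes "\<forall>k\<le>3. even (level (J + k) + c)"
  shows False
proof -
  have "even (level J + c)"
    using assms[rule_format, of 0] by simp
  then show False
    using level_parity_changes[of J] assms by auto
qed

lemma level_add_n: "level (J + n) = level J + P"
  using n_pos by (simp add: level_def)

lemma opp_less: "opp t i < n"
  using n_pos by (simp add: opp_def)

lemma add_eq_opp:
  assumes "i < n"
  shows "t + n = i + opp t i + n * ((t + n - i) div n)"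
proof -
  have "t + n - i = opp t i + n * ((t + n - i) div n)"
    by (simp add: opp_def)
  then show ?thesis using assms by linarith
qed

text \<open>The quotient in \<open>add_eq_opp\<close> is symmetric in the two players, so both find
  the same round and hence the same rank.\<close>

lemma opp_opp:
  assumes "i < n"
  shows "opp t (opp t i) = i" and "rank t (opp t i) = rank t i"
proof -
  let ?q = "(t + n - i) div n"
  have *: "t + n - opp t i = i + n * ?q"
    using add_eq_opp[OF assms, of t] by linarith
  then show 1: "opp t (opp t i) = i"
    using assms by (simp add: opp_def[of t "opp t i"])
  have "level (t + n - opp t i) = g i + P * ?q"
    using assms n_pos by (simp add: * level_def)
  then show "rank t (opp t i) = rank t i"
    by (simp add: rank_def level_def opp_def)
qed

lemma opp_eq_iff:
  assumes "i < n" "j < n"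
  shows "opp t i = j \<longleftrightarrow> t mod n = (i + j) mod n"
proof
  assume "opp t i = j"
  then have "t + n = i + j + n * ((t + n - i) div n)"
    using add_eq_opp[OF assms(1), of t] by simp
  then show "t mod n = (i + j) mod n"
    by (metis mod_add_self2 mod_mult_self2)
next
  assume *: "t mod n = (i + j) mod n"
  have "(t + n) mod n = (i + opp t i) mod n"
    using add_eq_opp[OF assms(1), of t] by (metis mod_mult_self2)
  then have "(i + opp t i) mod n = (i + j) mod n"
    using * by simp
  \<comment> \<open>Adding \<open>n - i\<close> cancels \<open>i\<close> modulo
    \<open>n\<close>.\<close>
  then have "(i + opp t i + (n - i)) mod n = (i + j + (n - i)) mod n"
    by (metis mod_add_left_eq)
  then show "opp t i = j"
    using assms opp_less[of t i] by simp
qed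

lemma bij_betw_opp: "bij_betw (opp t) {..<n} {..<n}"
  by (rule bij_betw_byWitness[where f' = "opp t"]) (auto simp: opp_opp opp_less)

lemma bij_betw_opp_day:
  assumes "i < n"
  shows "bij_betw (\<lambda>t. opp t i) {..<n} {..<n}"
proof (rule bij_betw_byWitness[where f' = "\<lambda>j. (i + j) mod n"])
  show "\<forall>t\<in>{..<n}. (i + opp t i) mod n = t"
    using opp_eq_iff[OF assms opp_less] by (metis lessThan_iff mod_less)
  show "\<forall>j\<in>{..<n}. opp ((i + j) mod n) i = j"
    using opp_eq_iff[OF assms] by auto
qed (use opp_less n_pos in auto)

lemma opp_add_n: "i < n \<Longrightarrow> opp (t + n) i = opp t i"
  using mod_add_self2[of "t + n - i" n] by (simp add: opp_def)

lemma rank_add_n: "i < n \<Longrightarrow> rank (t + n) i = rank t i + P"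
  using level_add_n[of "t + n - i"] by (simp add: rank_def)

text \<open>A game found from one team is found again from its opponent with the same rank; the
  changed bit makes up for the exchanged roles.\<close>

lemma cyclic_schedule_swap:
  "cyclic_schedule b A B t = cyclic_schedule (Suc b) B A t"
proof -
  have *: "cyclic_schedule b A B t \<subseteq> cyclic_schedule (Suc b) B A t" for b and A B :: "nat \<Rightarrow> 'a"
  proof
    fix e assume "e \<in> cyclic_schedule b A B t"
    then obtain i where i: "i < n" "e = game b A B t i"
      by (auto simp: cyclic_schedule_def)
    then have "e = game (Suc b) B A t (opp t i)"
      by (auto simp: game_def opp_opp)
    then show "e \<in> cyclic_schedule (Suc b) B A t"
      using opp_less by (auto simp: cyclic_schedule_def)
  qed
  \<comment> \<open>Only the parity of \<open>b\<close> matters, so applying the inclusion twice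
    leads back to the start.\<close>
  have "cyclic_schedule (Suc (Suc b)) A B t = cyclic_schedule b A B t"
    by (simp add: cyclic_schedule_def game_def)
  then show ?thesis
    using *[of b A B] *[of "Suc b" B A] by auto
qed

end

section \<open>Feasibility of the cyclic schedule\<close>

locale seeding = grouping n P g for n P :: nat and g :: "nat \<Rightarrow> nat" +
  fixes X Y :: "'a set" and A B :: "nat \<Rightarrow> 'a" and b :: nat
  assumes bij_A: "bij_betw A {..<n} X"
    and bij_B: "bij_betw B {..<n} Y"
    and disjoint: "X \<inter> Y = {}"
begin

abbreviation "S \<equiv> cyclic_schedule b A B"

text \<open>Reduces claims about the teams of \<open>Y\<close> to those about the teams of
  \<open>X\<close>.\<close>

lemma seeding_swap: "seeding n P g Y X B A"
  using bij_A bij_B disjoint by unfold_locales auto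

lemma A_in: "i < n \<Longrightarrow> A i \<in> X" and B_in: "i < n \<Longrightarrow> B i \<in> Y"
  using bij_A bij_B by (auto simp: bij_betw_def)

lemma A_eq_iff: "i < n \<Longrightarrow> j < n \<Longrightarrow> A i = A j \<longleftrightarrow> i = j"
  and B_eq_iff: "i < n \<Longrightarrow> j < n \<Longrightarrow> B i = B j \<longleftrightarrow> i = j"
  using bij_A bij_B by (auto simp: bij_betw_def inj_on_def)

lemma A_neq_B: "i < n \<Longrightarrow> j < n \<Longrightarrow> A i \<noteq> B j"
  using A_in[of i] B_in[of j] disjoint by auto

lemma X_cases:
  assumes "x \<in> X"
  obtains i where "i < n" "x = A i"
  using assms bij_A by (auto simp: bij_betw_def)

lemma S_swap: "S = cyclic_schedule (Suc b) B A"
  using cyclic_schedule_swap by blast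

lemma game_of_team_iff:
  assumes "i < n"
  shows "e \<in> S t \<and> (A i = fst e \<or> A i = snd e) \<longleftrightarrow> e = game b A B t i"
proof
  assume *: "e \<in> S t \<and> (A i = fst e \<or> A i = snd e)"
  then obtain k where k: "k < n" "e = game b A B t k"
    by (auto simp: cyclic_schedule_def)
  then have "A i = A k"
    using * A_neq_B[OF assms opp_less, of t k] by (auto simp: game_def split: if_splits)
  then show "e = game b A B t i"
    using A_eq_iff assms k by simp
next
  assume "e = game b A B t i"
  then show "e \<in> S t \<and> (A i = fst e \<or> A i = snd e)"
    using assms by (auto simp: cyclic_schedule_def game_def)
qed

lemma home_game_iff:
  assumes "i < n"
  shows "(A i, v) \<in> S t \<longleftrightarrow> even (rank t i + b) \<and> v = B (opp t i)"
  using game_of_team_iff[OF assms, of "(A i, v)" t] A_neq_B[OF assms opp_less, of t i]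
  by (auto simp: game_def)

lemma away_game_iff:
  assumes "i < n"
  shows "(v, A i) \<in> S t \<longleftrightarrow> odd (rank t i + b) \<and> v = B (opp t i)"
  using game_of_team_iff[OF assms, of "(v, A i)" t] A_neq_B[OF assms opp_less, of t i]
  by (auto simp: game_def)

lemma plays_home_iff: "i < n \<Longrightarrow> plays_home S t (A i) \<longleftrightarrow> even (rank t i + b)"
  by (simp add: plays_home_def home_game_iff)

lemma plays_away_iff: "i < n \<Longrightarrow> plays_away S t (A i) \<longleftrightarrow> odd (rank t i + b)"
  by (simp add: plays_away_def away_game_iff)

lemma venue_eq:
  "i < n \<Longrightarrow> venue S t (A i) = (if even (rank t i + b) then A i else B (opp t i))"
  by (simp add: venue_def plays_home_iff away_game_iff)

text \<open>The two meetings of a pair lie \<open>n\<close> days apart, and \<open>P\<close> is odd.\<close>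

lemma unique_meeting_day:
  assumes "i < n" "j < n"
  shows "\<exists>!t. t < 2 * n \<and> even (rank t i + c) \<and> opp t i = j"
proof -
  define t\<^sub>0 where "t\<^sub>0 = (i + j) mod n"
  have t\<^sub>0: "t\<^sub>0 < n"
    using n_pos by (simp add: t\<^sub>0_def)
  have days: "t < 2 * n \<and> opp t i = j \<longleftrightarrow> t = t\<^sub>0 \<or> t = t\<^sub>0 + n" for t
  proof -
    have "t < 2 * n \<Longrightarrow> t mod n = (if t < n then t else t - n)"
      by (simp add: le_mod_geq not_less)
    then show ?thesis
      using t\<^sub>0 opp_eq_iff[OF assms, of t] by (auto simp flip: t\<^sub>0_def)
  qed
  have "rank (t\<^sub>0 + n) i = rank t\<^sub>0 i + P"
    using rank_add_n assms by simp
  then have "even (rank (t\<^sub>0 + n) i + c) \<longleftrightarrow> odd (rank t\<^sub>0 i + c)"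
    using odd_P by auto
  then show ?thesis
    using days n_pos by (metis add_eq_self_zero less_not_refl)
qed

lemma unique_home_day:
  assumes "x \<in> X" "y \<in> Y"
  shows "\<exists>!t. t < 2 * n \<and> (x, y) \<in> S t"
proof -
  obtain i where i: "i < n" "x = A i" using assms X_cases by blast
  obtain j where j: "j < n" "y = B j" using assms bij_B by (auto simp: bij_betw_def)
  have "(x, y) \<in> S t \<longleftrightarrow> even (rank t i + b) \<and> opp t i = j" for t
    using home_game_iff i j B_eq_iff opp_less by metis
  then show ?thesis
    using unique_meeting_day[OF i(1) j(1)] by simp
qed

lemma unique_game: "u \<in> X \<Longrightarrow> \<exists>!e. e \<in> S t \<and> (u = fst e \<or> u = snd e)"
  by (erule X_cases) (auto simp: game_of_team_iff simp del: split_paired_Ex)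

lemma no_four_in_a_row:
  assumes "u \<in> X"
  shows "\<not> (\<forall>k\<le>3. plays_home S (t + k) u)" and "\<not> (\<forall>k\<le>3. plays_away S (t + k) u)"
proof -
  obtain i where i: "i < n" "u = A i" using assms X_cases by blast
  \<comment> \<open>From day to day only the level moves, along consecutive positions; the team's
    own group number is a constant.\<close>
  have *: "rank (t + k) i = level (t + n - i + k) + g i" for k
    using i by (simp add: rank_def algebra_simps)
  show "\<not> (\<forall>k\<le>3. plays_home S (t + k) u)"
    using level_parity_alternates[of "t + n - i" "g i + b"] i
    by (auto simp: plays_home_iff * add.assoc)
  \<comment> \<open>\<open>Suc\<close> turns odd into even, so the same parity lemma excludes four
    away games.\<close>
  show "\<not> (\<forall>k\<le>3. plays_away S (t + k) u)"
    using level_parity_alternates[of "t + n - i" "Suc (g i + b)"] i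
    by (auto simp: plays_away_iff * add.assoc)
qed

lemma feasible_cyclic_schedule: "feasible n X Y S"
proof -
  interpret swap: seeding n P g Y X B A "Suc b"
    by (rule seeding_swap)
  have subset: "S t \<subseteq> X \<times> Y \<union> Y \<times> X" for t
    using A_in B_in opp_less by (auto simp: cyclic_schedule_def game_def)
  have no_repeat: "(h, a) \<notin> S (t + 1) \<and> (a, h) \<notin> S (t + 1)" if game: "(h, a) \<in> S t" for h a t
  proof -
    obtain i where i: "i < n" "(h, a) = game b A B t i"
      using game unfolding cyclic_schedule_def by blast
    \<comment> \<open>Equal opponents would make consecutive days congruent modulo \<open>n\<close>,
      which is impossible for \<open>n \<ge> 2\<close>.\<close>
    have "opp (t + 1) i \<noteq> opp t i"
    proof
      assume "opp (t + 1) i = opp t i"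
      then have "(t + 1) mod n = t mod n"
        using opp_eq_iff[OF i(1) opp_less[of t i], of t]
          opp_eq_iff[OF i(1) opp_less[of t i], of "t + 1"] by simp
      then show False
        using n_ge_2 by (auto simp: mod_Suc split: if_splits)
    qed
    then have "B (opp t i) \<noteq> B (opp (t + 1) i)"
      using B_eq_iff opp_less by metis
    then show ?thesis
      using i home_game_iff[OF i(1)] away_game_iff[OF i(1)] by (auto simp: game_def split: if_splits)
  qed
  note swap_facts = swap.unique_home_day[folded S_swap] swap.unique_game[folded S_swap]
      swap.no_four_in_a_row[folded S_swap]
  show ?thesis
    unfolding feasible_def
  proof (intro conjI allI impI ballI)
    show "S t \<subseteq> X \<times> Y \<union> Y \<times> X" for t
      by (rule subset)
    show "\<exists>!t. t < 2 * n \<and> (x, y) \<in> S t" "\<exists>!t. t < 2 * n \<and> (y, x) \<in> S t"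
      if "x \<in> X" "y \<in> Y" for x y
      using that unique_home_day swap_facts(1) by auto
    show "\<exists>!e. e \<in> S t \<and> (u = fst e \<or> u = snd e)" if "u \<in> X \<union> Y" for u t
      using that unique_game swap_facts(2) by blast
    show "case e of (h, a) \<Rightarrow> (h, a) \<notin> S (t + 1) \<and> (a, h) \<notin> S (t + 1)" if "e \<in> S t" for e t
      using that no_repeat by (cases e) auto
    show "\<not> (\<forall>k\<le>3. plays_home S (t + k) u)" "\<not> (\<forall>k\<le>3. plays_away S (t + k) u)"
      if "u \<in> X \<union> Y" for u t
      using that no_four_in_a_row swap_facts(3,4) by blast+
  qed
qed

end


section \<open>The weight of the cyclic schedule\<close>

lemma sum_lessThan_split:
  fixes f :: "nat \<Rightarrow> real"
  assumes "k \<le> n"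
  shows "(\<Sum>i<n. f i) = (\<Sum>i<k. f i) + (\<Sum>i\<in>{k..<n}. f i)"
proof -
  have "{..<n} = {..<k} \<union> {k..<n}"
    using assms by auto
  then show ?thesis
    by (simp add: sum.union_disjoint ivl_disj_int)
qed

text \<open>Serves as a bound for the weight of all pairs outside \<open>U \<times> V\<close>; a
  pair with both teams outside is counted twice.\<close>

definition low_weight :: "('a \<Rightarrow> 'a \<Rightarrow> real) \<Rightarrow> 'a set \<Rightarrow> 'a set \<Rightarrow> 'a set \<Rightarrow> 'a set \<Rightarrow> real" where
  "low_weight w X Y U V = (\<Sum>x\<in>X - U. delta w Y x) + (\<Sum>y\<in>Y - V. delta w X y)"

section \<open>Charging trips to away games\<close>

locale path_seeding = seeding n P g X Y A B b
  for n P :: nat and g :: "nat \<Rightarrow> nat" and X Y :: "'a set" and A B :: "nat \<Rightarrow> 'a" and b :: nat +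
  fixes w :: "'a \<Rightarrow> 'a \<Rightarrow> real" and M :: nat
  assumes instance_w: "bttp_instance n X Y w"
    and paths_le: "3 * M \<le> n"
    and g_path: "\<And>i. i < 3 * M \<Longrightarrow> g i = i div 3"
begin

lemma path_seeding_swap: "path_seeding n P g Y X B A w M"
proof -
  interpret swap: seeding n P g Y X B A "Suc b"
    by (rule seeding_swap)
  show ?thesis
    using instance_w paths_le g_path
    by unfold_locales (auto simp: bttp_instance_def Int_commute Un_commute)
qed

lemma w_nonneg: "u \<in> X \<union> Y \<Longrightarrow> v \<in> X \<union> Y \<Longrightarrow> 0 \<le> w u v"
  and w_commute: "u \<in> X \<union> Y \<Longrightarrow> v \<in> X \<union> Y \<Longrightarrow> w u v = w v u"
  and w_self: "u \<in> X \<union> Y \<Longrightarrow> w u u = 0"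
  and w_triangle: "u \<in> X \<union> Y \<Longrightarrow> v \<in> X \<union> Y \<Longrightarrow> z \<in> X \<union> Y \<Longrightarrow> w u z \<le> w u v + w v z"
  using instance_w by (auto simp: bttp_instance_def)

lemma AB_in: "i < n \<Longrightarrow> A i \<in> X \<union> Y" "i < n \<Longrightarrow> B i \<in> X \<union> Y"
  using A_in B_in by auto

lemma w_AB_nonneg: "i < n \<Longrightarrow> j < n \<Longrightarrow> 0 \<le> w (A i) (B j)"
  using w_nonneg AB_in by blast

text \<open>The part of the travel of \<open>A i\<close> charged to its away game at
  \<open>B j\<close>. On a path the first game pays the way in and the first edge, the middle one
  the second edge, the last one the way home. Any other game pays a full return trip.\<close>

definition visit_cost :: "nat \<Rightarrow> nat \<Rightarrow> real" where
  "visit_cost i j =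
     (if i < 3 * M \<and> j < 3 * M
      then (if j mod 3 = 0 then w (A i) (B j) + w (B j) (B (Suc j))
            else if j mod 3 = 1 then w (B j) (B (Suc j)) else w (A i) (B j))
      else 2 * w (A i) (B j))"

text \<open>Neither the group nor the round of the opponent changes between neighbours on a path, so
  a trip is not interrupted there.\<close>

lemma next_on_path:
  assumes i: "i < n" and j: "Suc (opp t i) < 3 * M" and mod3: "opp t i mod 3 \<noteq> 2"
  shows "opp (Suc t) i = Suc (opp t i)" and "rank (Suc t) i = rank t i"
proof -
  let ?J = "t + n - i"
  have J: "Suc t + n - i = Suc ?J"
    using i by simp
  have "Suc (?J mod n) < n"
    using j paths_le by (simp add: opp_def)
  then have *: "Suc ?J mod n = Suc (?J mod n)" "Suc ?J div n = ?J div n"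
    by (auto simp: mod_Suc div_Suc)
  then show "opp (Suc t) i = Suc (opp t i)"
    by (simp only: opp_def J)
  have "g (Suc (?J mod n)) = g (?J mod n)"
    using j mod3 by (auto simp: g_path opp_def div_Suc mod_Suc split: if_splits)
  then show "rank (Suc t) i = rank t i"
    unfolding rank_def level_def J * by simp
qed

text \<open>A wrap-around would lead to position 0, which is divisible by three.\<close>

lemma previous_on_path:
  assumes i: "i < n" and j: "opp (Suc t) i mod 3 \<noteq> 0"
  shows "opp (Suc t) i = Suc (opp t i)"
proof -
  have "opp (Suc t) i = Suc (t + n - i) mod n"
    using i by (simp add: opp_def Suc_diff_le)
  then show ?thesis
    using j by (auto simp: opp_def mod_Suc split: if_splits)
qed

text \<open>Each edge of a trip is charged to the games at its ends, except that an edge of a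
  visited path is charged to its earlier end. Only the first and the last day can interrupt the
  visit of a path.\<close>

lemma travel_le:
  assumes i: "i < n"
  shows "travel n w S (A i)
    \<le> (\<Sum>j<n. visit_cost i j) + w (A i) (B (opp 0 i)) + w (A i) (B (opp (2 * n - 1) i))"
proof -
  define u where "u = A i"
  define v where "v t = B (opp t i)" for t
  define away where "away t \<longleftrightarrow> odd (rank t i + b)" for t
  \<comment> \<open>\<open>starts\<close> and \<open>ends\<close> fail only at those path positions
    where the trip comes from, or goes on to, a neighbour on the path.\<close>
  define starts where "starts t \<longleftrightarrow> \<not> (i < 3 * M \<and> opp t i < 3 * M \<and> opp t i mod 3 \<noteq> 0)" for t
  define ends where "ends t \<longleftrightarrow> \<not> (i < 3 * M \<and> opp t i < 3 * M \<and> opp t i mod 3 \<noteq> 2)" for t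
  define arrival where "arrival t = (if away t \<and> starts t then w u (v t) else 0)" for t
  define departure where
    "departure t = (if \<not> away t then 0 else if ends t then w u (v t) else w (v t) (B (Suc (opp t i))))"
    for t
  define x where "x t = venue S t u" for t
  have in_teams: "u \<in> X \<union> Y" "v t \<in> X \<union> Y" for t
    using AB_in i opp_less by (auto simp: u_def v_def)
  have x_eq: "x t = (if away t then v t else u)" for t
    by (simp add: x_def u_def v_def away_def venue_eq i)
  have x_in: "x t \<in> X \<union> Y" for t
    using in_teams by (simp add: x_eq)
  have on_path: "Suc (opp t i) < 3 * M" if "opp t i < 3 * M" "opp t i mod 3 \<noteq> 2" for t
    using that by presburger
  have continues: "opp (Suc t) i = Suc (opp t i)" "away (Suc t) = away t" "\<not> starts (Suc t)"
    if "\<not> ends t" for t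
  proof -
    have *: "i < 3 * M" "opp t i < 3 * M" "opp t i mod 3 \<noteq> 2"
      using that by (auto simp: ends_def)
    note next_t = next_on_path[OF i on_path[OF *(2,3)] *(3)]
    show "opp (Suc t) i = Suc (opp t i)" "away (Suc t) = away t"
      using next_t by (simp_all add: away_def)
    show "\<not> starts (Suc t)"
      using * on_path[OF *(2,3)] next_t(1) by (auto simp: starts_def mod_Suc)
  qed
  have not_ends: "\<not> ends t" if "\<not> starts (Suc t)" for t
  proof -
    have *: "i < 3 * M" "opp (Suc t) i < 3 * M" "opp (Suc t) i mod 3 \<noteq> 0"
      using that by (auto simp: starts_def)
    then show ?thesis
      using previous_on_path[OF i *(3)] by (auto simp: ends_def mod_Suc split: if_splits)
  qed
  \<comment> \<open>An edge inside a path visit is paid by the departure alone; any other edge is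
    replaced by a detour through home.\<close>
  have edge: "w (x t) (x (Suc t)) \<le> departure t + arrival (Suc t)" for t
  proof (cases "away t \<and> \<not> ends t")
    case True
    then show ?thesis
      using continues[of t] by (simp add: x_eq departure_def arrival_def v_def)
  next
    case False
    then have "departure t = w u (x t)"
      using w_self in_teams by (simp add: departure_def x_eq)
    moreover have "arrival (Suc t) = w u (x (Suc t))"
      using False not_ends[of t] continues(2)[of t] w_self in_teams
      by (auto simp: arrival_def x_eq)
    ultimately show ?thesis
      using w_triangle[OF x_in in_teams(1) x_in, of t "Suc t"] w_commute[OF x_in in_teams(1), of t]
      by simp
  qed
  \<comment> \<open>If the schedule opens in the middle of a path, no arrival is charged and the
    extra term pays the way out.\<close>
  have first: "w u (x 0) \<le> arrival 0 + w u (v 0)"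
    using w_nonneg in_teams w_self by (auto simp: arrival_def x_eq)
  have departure_nonneg: "0 \<le> departure t" for t
  proof (cases "away t \<and> \<not> ends t")
    case True
    then have "B (Suc (opp t i)) = v (Suc t)"
      using continues[of t] by (simp add: v_def)
    then show ?thesis
      using w_nonneg in_teams by (simp add: departure_def)
  qed (use w_nonneg in_teams in \<open>simp add: departure_def\<close>)
  \<comment> \<open>If the last day cuts a path visit short, the extra term pays the way home, and
    of the departure only its sign is needed.\<close>
  have last: "w (x (2 * n - 1)) u \<le> departure (2 * n - 1) + w u (v (2 * n - 1))"
    using departure_nonneg[of "2 * n - 1"] w_nonneg in_teams w_self w_commute[OF x_in in_teams(1)]
    by (auto simp: x_eq)
  have charge: "arrival t + departure t = (if away t then visit_cost i (opp t i) else 0)" for t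
  proof -
    consider "opp t i mod 3 = 0" | "opp t i mod 3 = 1" | "opp t i mod 3 = 2"
      by linarith
    then show ?thesis
      by cases (auto simp: arrival_def departure_def starts_def ends_def visit_cost_def u_def v_def)
  qed
  obtain N where N: "2 * n = Suc N"
    using n_pos by (metis Suc_pred nat_0_less_mult_iff pos2)
  have "travel n w S u = w u (x 0) + (\<Sum>t<N. w (x t) (x (Suc t))) + w (x N) u"
    using N by (simp add: travel_def x_def)
  also have "\<dots> \<le> arrival 0 + (\<Sum>t<N. departure t + arrival (Suc t)) + departure N
      + w u (v 0) + w u (v N)"
  proof -
    have "(\<Sum>t<N. w (x t) (x (Suc t))) \<le> (\<Sum>t<N. departure t + arrival (Suc t))"
      by (intro sum_mono edge)
    then show ?thesis
      using first last N by simp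
  qed
  also have "arrival 0 + (\<Sum>t<N. departure t + arrival (Suc t)) + departure N
      = (\<Sum>t<Suc N. arrival t + departure t)"
    using sum.lessThan_Suc_shift[of arrival N] by (simp add: sum.distrib)
  also have "\<dots> = (\<Sum>t<n + n. if away t then visit_cost i (opp t i) else 0)"
    using N by (simp only: charge mult_2)
  also have "\<dots> = (\<Sum>t<n. (if away t then visit_cost i (opp t i) else 0)
      + (if away (t + n) then visit_cost i (opp (t + n) i) else 0))"
    using sum_lessThan_split[of n "n + n" "\<lambda>t. if away t then visit_cost i (opp t i) else 0"]
      sum.shift_bounds_nat_ivl[of "\<lambda>t. if away t then visit_cost i (opp t i) else 0" 0 n n]
    by (simp add: sum.distrib lessThan_atLeast0)
  \<comment> \<open>Days \<open>t\<close> and \<open>t + n\<close> have the same opponent, and as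
    \<open>P\<close> is odd exactly one of them is an away game.\<close>
  also have "\<dots> = (\<Sum>t<n. visit_cost i (opp t i))"
    using odd_P i by (intro sum.cong) (auto simp: away_def opp_add_n rank_add_n)
  also have "\<dots> = (\<Sum>j<n. visit_cost i j)"
    using sum.reindex_bij_betw[OF bij_betw_opp_day[OF i]] .
  finally show ?thesis
    using N by (simp add: u_def v_def)
qed

definition day_weight :: "nat \<Rightarrow> real" where
  "day_weight t = (\<Sum>i<n. w (A i) (B (opp t i)))"

definition path_day_weight :: "nat \<Rightarrow> real" where
  "path_day_weight t = (\<Sum>i<n. if i < 3 * M \<and> opp t i < 3 * M then w (A i) (B (opp t i)) else 0)"

lemma sum_travel_le:
  "(\<Sum>x\<in>X. travel n w S x)
    \<le> (\<Sum>i<n. \<Sum>j<n. visit_cost i j) + day_weight 0 + day_weight (2 * n - 1)"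
proof -
  have "(\<Sum>x\<in>X. travel n w S x) = (\<Sum>i<n. travel n w S (A i))"
    using sum.reindex_bij_betw[OF bij_A, of "travel n w S"] by simp
  also have "\<dots> \<le> (\<Sum>i<n. (\<Sum>j<n. visit_cost i j) + w (A i) (B (opp 0 i))
      + w (A i) (B (opp (2 * n - 1) i)))"
    by (intro sum_mono travel_le) simp
  also have "\<dots> = (\<Sum>i<n. \<Sum>j<n. visit_cost i j) + day_weight 0 + day_weight (2 * n - 1)"
    by (simp add: sum.distrib day_weight_def)
  finally show ?thesis .
qed

lemma delta_A: "i < n \<Longrightarrow> delta w Y (A i) = (\<Sum>j<n. w (A i) (B j))"
  unfolding delta_def by (rule sum.reindex_bij_betw[OF bij_B, symmetric])

lemma delta_B:
  assumes "j < n"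
  shows "delta w X (B j) = (\<Sum>i<n. w (A i) (B j))"
proof -
  have "delta w X (B j) = (\<Sum>i<n. w (B j) (A i))"
    unfolding delta_def by (rule sum.reindex_bij_betw[OF bij_A, symmetric])
  then show ?thesis
    using w_commute AB_in assms by simp
qed

lemma sum_low:
  "(\<Sum>x\<in>X - A ` {..<3 * M}. f x) = (\<Sum>i\<in>{3 * M..<n}. f (A i))"
  "(\<Sum>y\<in>Y - B ` {..<3 * M}. f y) = (\<Sum>i\<in>{3 * M..<n}. f (B i))"
  for f :: "'a \<Rightarrow> real"
proof -
  have "bij_betw h {3 * M..<n} (Z - h ` {..<3 * M})" if h: "bij_betw h {..<n} Z" for h and Z :: "'a set"
  proof -
    have "bij_betw h {..<3 * M} (h ` {..<3 * M})"
      using h paths_le by (auto intro: bij_betw_subset)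
    then have "bij_betw h ({..<n} - {..<3 * M}) (Z - h ` {..<3 * M})"
      using h paths_le by (intro bij_betw_DiffI) (auto simp: bij_betw_def)
    moreover have "{..<n} - {..<3 * M} = {3 * M..<n}"
      by auto
    ultimately show ?thesis
      by simp
  qed
  from this[OF bij_A] this[OF bij_B]
  show
    "(\<Sum>x\<in>X - A ` {..<3 * M}. f x) = (\<Sum>i\<in>{3 * M..<n}. f (A i))"
    "(\<Sum>y\<in>Y - B ` {..<3 * M}. f y) = (\<Sum>i\<in>{3 * M..<n}. f (B i))"
    by (metis sum.reindex_bij_betw)+
qed

abbreviation "R \<equiv> low_weight w X Y (A ` {..<3 * M}) (B ` {..<3 * M})"

lemma low_weight_eq:
  "R = (\<Sum>i\<in>{3 * M..<n}. \<Sum>j<n. w (A i) (B j)) + (\<Sum>j\<in>{3 * M..<n}. \<Sum>i<n. w (A i) (B j))"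
  by (simp add: low_weight_def sum_low delta_A delta_B)

text \<open>Each of the \<open>3 * M\<close> visitors on paths pays every path edge once and one way
  to each terminal, which gives the packing terms exactly. Any other pair pays a return trip and
  contains a team off the paths, hence \<open>2 * R\<close>.\<close>

lemma sum_visit_cost_le:
  assumes Q: "bij_betw (\<lambda>p. (B (3 * p), B (3 * p + 1), B (3 * p + 2))) {..<M} Q"
  shows "(\<Sum>i<n. \<Sum>j<n. visit_cost i j)
    \<le> delta_packing w (A ` {..<3 * M}) Q + real (3 * M) * packing_weight w Q + 2 * R"
proof -
  have path_part: "(\<Sum>i<3 * M. \<Sum>j<3 * M. visit_cost i j)
      = delta_packing w (A ` {..<3 * M}) Q + real (3 * M) * packing_weight w Q"
  proof -
    define e where "e p = w (B (3 * p)) (B (3 * p + 1)) + w (B (3 * p + 1)) (B (3 * p + 2))" for p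
    have delta_eq: "delta w (A ` {..<3 * M}) (B j) = (\<Sum>i<3 * M. w (A i) (B j))" if "j < n" for j
    proof -
      have "inj_on A {..<3 * M}"
        using paths_le A_eq_iff by (auto simp: inj_on_def)
      then have "delta w (A ` {..<3 * M}) (B j) = (\<Sum>i<3 * M. w (B j) (A i))"
        by (simp add: delta_def sum.reindex)
      then show ?thesis
        using w_commute AB_in that paths_le by (auto intro!: sum.cong)
    qed
    have "(\<Sum>j<3 * M. visit_cost i j) = (\<Sum>p<M. w (A i) (B (3 * p)) + e p + w (A i) (B (3 * p + 2)))"
      if "i < 3 * M" for i
    proof -
      have "(\<Sum>j<3 * M. visit_cost i j) = (\<Sum>p<M. \<Sum>j\<in>{p * 3..<p * 3 + 3}. visit_cost i j)"
        using sum.nat_group[of "visit_cost i" 3 M] by (simp add: mult.commute)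
      also have "\<dots> = (\<Sum>p<M. w (A i) (B (3 * p)) + e p + w (A i) (B (3 * p + 2)))"
      proof (intro sum.cong refl)
        fix p assume "p \<in> {..<M}"
        moreover have "{p * 3..<p * 3 + 3} = {3 * p, 3 * p + 1, 3 * p + 2}"
          by auto
        moreover have "(3 * p + 1) mod 3 = 1" "(3 * p + 2) mod 3 = 2" "(3 * p) mod 3 = 0"
          by presburger+
        ultimately show "(\<Sum>j\<in>{p * 3..<p * 3 + 3}. visit_cost i j)
            = w (A i) (B (3 * p)) + e p + w (A i) (B (3 * p + 2))"
          using that by (simp add: visit_cost_def e_def)
      qed
      finally show ?thesis .
    qed
    then have "(\<Sum>i<3 * M. \<Sum>j<3 * M. visit_cost i j)
        = (\<Sum>p<M. \<Sum>i<3 * M. w (A i) (B (3 * p)) + e p + w (A i) (B (3 * p + 2)))"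
      by (simp add: sum.swap[of _ "{..<M}"])
    also have "\<dots> = (\<Sum>p<M. delta w (A ` {..<3 * M}) (B (3 * p))
        + delta w (A ` {..<3 * M}) (B (3 * p + 2)) + real (3 * M) * e p)"
      using paths_le by (intro sum.cong) (auto simp: sum.distrib delta_eq)
    also have "\<dots> = delta_packing w (A ` {..<3 * M}) Q + real (3 * M) * packing_weight w Q"
      unfolding delta_packing_def packing_weight_def sum.reindex_bij_betw[OF Q, symmetric]
      by (simp add: sum.distrib sum_distrib_left distrib_left e_def)
    finally show ?thesis .
  qed
  have high_i: "visit_cost i j = 2 * w (A i) (B j)" if "\<not> (i < 3 * M \<and> j < 3 * M)" for i j
    using that by (auto simp: visit_cost_def)
  have "(\<Sum>i<n. \<Sum>j<n. visit_cost i j)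
      = (\<Sum>i<3 * M. \<Sum>j<3 * M. visit_cost i j) + (\<Sum>i<3 * M. \<Sum>j\<in>{3 * M..<n}. visit_cost i j)
        + (\<Sum>i\<in>{3 * M..<n}. \<Sum>j<n. visit_cost i j)"
    unfolding sum_lessThan_split[OF paths_le, of "\<lambda>i. \<Sum>j<n. visit_cost i j"]
    by (simp add: sum_lessThan_split[OF paths_le, of "visit_cost _"] sum.distrib)
  moreover have "(\<Sum>i<3 * M. \<Sum>j\<in>{3 * M..<n}. visit_cost i j)
      \<le> 2 * (\<Sum>j\<in>{3 * M..<n}. \<Sum>i<n. w (A i) (B j))"
  proof -
    have "(\<Sum>i<3 * M. \<Sum>j\<in>{3 * M..<n}. visit_cost i j)
        = (\<Sum>j\<in>{3 * M..<n}. \<Sum>i<3 * M. 2 * w (A i) (B j))"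
      by (subst sum.swap) (auto intro!: sum.cong simp: high_i)
    also have "\<dots> \<le> (\<Sum>j\<in>{3 * M..<n}. \<Sum>i<n. 2 * w (A i) (B j))"
      using paths_le w_AB_nonneg by (intro sum_mono sum_mono2) auto
    finally show ?thesis
      by (simp add: sum_distrib_left)
  qed
  moreover have "(\<Sum>i\<in>{3 * M..<n}. \<Sum>j<n. visit_cost i j)
      = 2 * (\<Sum>i\<in>{3 * M..<n}. \<Sum>j<n. w (A i) (B j))"
    by (auto intro!: sum.cong simp: high_i sum_distrib_left)
  ultimately show ?thesis
    unfolding path_part low_weight_eq by simp
qed

text \<open>A meeting with a team off the paths is bounded by the whole degree of that team. As
  \<open>opp t\<close> is a permutation, no such degree is charged twice.\<close>

lemma day_weight_le: "day_weight t \<le> path_day_weight t + R"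
proof -
  let ?dX = "\<lambda>i. if 3 * M \<le> i then \<Sum>j<n. w (A i) (B j) else 0"
  let ?dY = "\<lambda>j. if 3 * M \<le> j then \<Sum>i<n. w (A i) (B j) else 0"
  have "day_weight t \<le> (\<Sum>i<n. (if i < 3 * M \<and> opp t i < 3 * M then w (A i) (B (opp t i)) else 0)
      + ?dX i + ?dY (opp t i))"
    unfolding day_weight_def
  proof (rule sum_mono)
    fix i assume i: "i \<in> {..<n}"
    have "w (A i) (B (opp t i)) \<le> (\<Sum>j<n. w (A i) (B j))"
      using i opp_less by (intro member_le_sum[of _ _ "\<lambda>j. w (A i) (B j)"]) (auto intro: w_AB_nonneg)
    moreover have "w (A i) (B (opp t i)) \<le> (\<Sum>k<n. w (A k) (B (opp t i)))"
      using i opp_less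
      by (intro member_le_sum[of _ _ "\<lambda>k. w (A k) (B (opp t i))"]) (auto intro: w_AB_nonneg)
    moreover have "0 \<le> (\<Sum>j<n. w (A i) (B j))" "0 \<le> (\<Sum>k<n. w (A k) (B (opp t i)))"
      using i opp_less by (auto intro!: sum_nonneg w_AB_nonneg)
    ultimately show "w (A i) (B (opp t i))
        \<le> (if i < 3 * M \<and> opp t i < 3 * M then w (A i) (B (opp t i)) else 0) + ?dX i + ?dY (opp t i)"
      by auto
  qed
  also have "\<dots> = path_day_weight t + (\<Sum>i<n. ?dX i) + (\<Sum>i<n. ?dY (opp t i))"
    by (simp add: sum.distrib path_day_weight_def)
  also have "(\<Sum>i<n. ?dY (opp t i)) = (\<Sum>j<n. ?dY j)"
    using sum.reindex_bij_betw[OF bij_betw_opp] .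
  also have "path_day_weight t + (\<Sum>i<n. ?dX i) + (\<Sum>j<n. ?dY j) = path_day_weight t + R"
    unfolding low_weight_eq sum_lessThan_split[OF paths_le] by simp
  finally show ?thesis .
qed

text \<open>In each league the visits contribute \<open>2 * R\<close> and the two end days
  \<open>R\<close> each, hence \<open>8 * R\<close> in total. The path meetings of the end days are
  paid by both leagues.\<close>

lemma schedule_weight_le:
  assumes QX: "bij_betw (\<lambda>p. (A (3 * p), A (3 * p + 1), A (3 * p + 2))) {..<M} QX"
    and QY: "bij_betw (\<lambda>p. (B (3 * p), B (3 * p + 1), B (3 * p + 2))) {..<M} QY"
  shows "schedule_weight n X Y w S
    \<le> delta_packing w (B ` {..<3 * M}) QX + real (3 * M) * packing_weight w QX
      + delta_packing w (A ` {..<3 * M}) QY + real (3 * M) * packing_weight w QY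
      + 8 * R + 2 * path_day_weight 0 + 2 * path_day_weight (2 * n - 1)"
proof -
  interpret swap: path_seeding n P g Y X B A "Suc b" w M
    by (rule path_seeding_swap)
  \<comment> \<open>Both leagues sum over the same games, and \<open>opp t\<close> translates
    between the two indexings.\<close>
  have swap_day: "swap.day_weight t = day_weight t" for t
  proof -
    have "day_weight t = (\<Sum>i<n. w (A (opp t i)) (B (opp t (opp t i))))"
      unfolding day_weight_def using sum.reindex_bij_betw[OF bij_betw_opp, of "\<lambda>i. w (A i) (B (opp t i))"] by simp
    then show ?thesis
      using w_commute AB_in opp_less by (simp add: swap.day_weight_def opp_opp)
  qed
  have swap_R: "swap.R = R"
    by (simp add: low_weight_def)
  have "schedule_weight n X Y w S = (\<Sum>x\<in>X. travel n w S x) + (\<Sum>y\<in>Y. travel n w S y)"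
    unfolding schedule_weight_def
    using instance_w by (intro sum.union_disjoint) (auto simp: bttp_instance_def)
  then show ?thesis
    using sum_travel_le swap.sum_travel_le[folded S_swap] sum_visit_cost_le[OF QY]
      swap.sum_visit_cost_le[OF QX] day_weight_le[of 0] day_weight_le[of "2 * n - 1"]
    unfolding swap_day swap_R by linarith
qed

end


section \<open>Lower bounds and averaging\<close>

text \<open>The output of the program is compared with the cyclic schedule only on the days before
  \<open>2 * n\<close>.\<close>

lemma feasible_cong:
  assumes "\<And>t. t < 2 * n \<Longrightarrow> G t = H t" and "feasible n X Y H"
  shows "feasible n X Y G"
proof -
  have days: "\<forall>t<2 * n. G t = H t"
    using assms(1) by blast
  have ex1: "(\<exists>!t. t < 2 * n \<and> e \<in> G t) \<longleftrightarrow> (\<exists>!t. t < 2 * n \<and> e \<in> H t)" for e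
    using days by metis
  show ?thesis
    using assms(2) days unfolding feasible_def ex1 plays_home_def plays_away_def
    by (simp cong: conj_cong)
qed

lemma schedule_weight_cong:
  assumes "\<And>t. t < 2 * n \<Longrightarrow> G t = H t" and "0 < n"
  shows "schedule_weight n X Y w G = schedule_weight n X Y w H"
proof -
  have "venue G t u = venue H t u" if "t < 2 * n" for t u
    using assms(1)[OF that] by (simp add: venue_def plays_home_def)
  then show ?thesis
    using \<open>0 < n\<close> by (simp add: schedule_weight_def travel_def)
qed

lemma feasible_commute:
  assumes "feasible n X Y G"
  shows "feasible n Y X G"
proof -
  have "Y \<union> X = X \<union> Y" "Y \<times> X \<union> X \<times> Y = X \<times> Y \<union> Y \<times> X"
    by blast+
  moreover have "\<forall>y\<in>Y. \<forall>x\<in>X.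
      (\<exists>!t. t < 2 * n \<and> (y, x) \<in> G t) \<and> (\<exists>!t. t < 2 * n \<and> (x, y) \<in> G t)"
    using assms by (simp add: feasible_def)
  ultimately show ?thesis
    using assms by (simp add: feasible_def)
qed

lemma bttp_instance_commute: "bttp_instance n X Y w \<Longrightarrow> bttp_instance n Y X w"
  by (auto simp: bttp_instance_def)

text \<open>Every away game is followed by a home game, or by the end of the schedule, within
  three days.\<close>

lemma delta_le_travel:
  assumes inst: "bttp_instance n X Y w" and feas: "feasible n X Y G" and u: "u \<in> X" and "0 < n"
  shows "delta w Y u \<le> 3 * travel n w G u"
proof -
  have nonneg: "0 \<le> w p q" and commute: "w p q = w q p" and self: "w p p = 0"
    if "p \<in> X \<union> Y" "q \<in> X \<union> Y" for p q
    using inst that by (auto simp: bttp_instance_def)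
  have triangle: "w p r \<le> w p q + w q r" if "p \<in> X \<union> Y" "q \<in> X \<union> Y" "r \<in> X \<union> Y" for p q r
    using inst that unfolding bttp_instance_def by blast
  have one_game: "\<exists>!e. e \<in> G t \<and> (u = fst e \<or> u = snd e)" if "t < 2 * n" for t
    using feas u that by (simp add: feasible_def)
  have days_subset: "G t \<subseteq> X \<times> Y \<union> Y \<times> X" if "t < 2 * n" for t
    using feas that by (simp add: feasible_def)
  have same_game: "e = e'"
    if "e \<in> G t" "e' \<in> G t" "t < 2 * n" "u = fst e \<or> u = snd e" "u = fst e' \<or> u = snd e'" for e e' t
    using one_game[OF that(3)] that by blast
  have away_venue: "venue G t u = h \<and> \<not> plays_home G t u" if "(h, u) \<in> G t" "t < 2 * n" for t h
  proof -
    have unique: "h' = h" if "(h', u) \<in> G t" for h'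
      using same_game[OF that \<open>(h, u) \<in> G t\<close> \<open>t < 2 * n\<close>] by simp
    have False if "(u, a) \<in> G t" for a
    proof -
      have "h = u"
        using same_game[OF that \<open>(h, u) \<in> G t\<close> \<open>t < 2 * n\<close>] by simp
      moreover have "(h, u) \<in> X \<times> Y \<union> Y \<times> X"
        using days_subset \<open>(h, u) \<in> G t\<close> \<open>t < 2 * n\<close> by blast
      ultimately show False
        using inst by (auto simp: bttp_instance_def)
    qed
    then have not_home: "\<not> plays_home G t u"
      by (auto simp: plays_home_def)
    have "(THE h. (h, u) \<in> G t) = h"
      using \<open>(h, u) \<in> G t\<close> unique by (rule the_equality)
    then show ?thesis
      using not_home by (simp add: venue_def)
  qed
  have home_or_away: "plays_home G t u \<or> plays_away G t u" if "t < 2 * n" for t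
    using ex1_implies_ex[OF one_game[OF that]] by (auto simp: plays_home_def plays_away_def)
  \<comment> \<open>Placing the team at home on all later days makes the final return an ordinary
    edge and every later edge zero.\<close>
  define pos where "pos s = (if s < 2 * n then venue G s u else u)" for s
  have pos_in: "pos s \<in> X \<union> Y" for s
  proof (cases "s < 2 * n \<and> \<not> plays_home G s u")
    case True
    then obtain h where h: "(h, u) \<in> G s"
      using home_or_away by (auto simp: plays_away_def)
    then have "(h, u) \<in> X \<times> Y \<union> Y \<times> X"
      using days_subset True by blast
    then show ?thesis
      using True away_venue[OF h] by (auto simp: pos_def)
  qed (use u in \<open>auto simp: pos_def venue_def\<close>)
  define e where "e s = w (pos s) (pos (Suc s))" for s
  have e_nonneg: "0 \<le> e s" for s
    using nonneg pos_in by (simp add: e_def)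
  have e_0: "e s = 0" if "2 * n \<le> s" for s
    using that self[of u u] u by (simp add: e_def pos_def)
  have chain: "w (pos t) (pos (t + k)) \<le> (\<Sum>l<k. e (t + l))" for t k
  proof (induction k)
    case (Suc k)
    then show ?case
      using triangle[OF pos_in[of t] pos_in[of "t + k"] pos_in[of "Suc (t + k)"]] by (simp add: e_def)
  qed (use self[OF pos_in[of t] pos_in[of t]] in simp)
  define T where "T y = (THE t. t < 2 * n \<and> (y, u) \<in> G t)" for y
  have T: "T y < 2 * n \<and> (y, u) \<in> G (T y)" if "y \<in> Y" for y
    unfolding T_def by (rule theI') (use feas u that in \<open>simp add: feasible_def\<close>)
  have venue_T: "venue G (T y) u = y" if "y \<in> Y" for y
    using away_venue[of y "T y"] T[OF that] by blast
  then have T_inj: "inj_on T Y"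
    by (rule inj_on_inverseI)
  \<comment> \<open>The team is home again at most three days after the game at \<open>y\<close>, so
    the edges of these days cover the distance from \<open>y\<close> to home.\<close>
  have visit: "w u y \<le> (\<Sum>k<3. e (T y + k))" if y: "y \<in> Y" for y
  proof -
    have pos_T: "pos (T y) = y"
      using T[OF y] venue_T[OF y] by (simp add: pos_def)
    have "\<exists>k\<le>3. pos (T y + k) = u"
    proof (cases "T y + 3 < 2 * n")
      case True
      then have "\<not> (\<forall>k\<le>3. plays_away G (T y + k) u)"
        using feas u by (simp add: feasible_def)
      then obtain k where k: "k \<le> 3" "\<not> plays_away G (T y + k) u"
        by blast
      moreover have "T y + k < 2 * n"
        using k True by simp
      ultimately have "plays_home G (T y + k) u"
        using home_or_away by blast
      then show ?thesis
        using k by (intro exI[of _ k]) (simp add: pos_def venue_def)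
    qed (auto simp: pos_def)
    then obtain k where k: "k \<le> 3" "pos (T y + k) = u"
      by blast
    have "w u y = w (pos (T y)) (pos (T y + k))"
      using commute u y by (simp add: k pos_T)
    also have "\<dots> \<le> (\<Sum>l<k. e (T y + l))"
      by (rule chain)
    also have "\<dots> \<le> (\<Sum>l<3. e (T y + l))"
      using k e_nonneg by (intro sum_mono2) auto
    finally show ?thesis .
  qed
  have fin: "finite Y"
    using inst by (simp add: bttp_instance_def)
  have shift: "(\<Sum>t<2 * n. e (t + k)) \<le> (\<Sum>s<2 * n. e s)" for k
  proof -
    have "(\<Sum>t<2 * n. e (t + k)) = (\<Sum>s\<in>{k..<2 * n + k}. e s)"
      using sum.shift_bounds_nat_ivl[of e 0 k "2 * n"] by (simp add: lessThan_atLeast0)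
    also have "\<dots> \<le> (\<Sum>s<2 * n + k. e s)"
      using e_nonneg by (intro sum_mono2) auto
    also have "\<dots> = (\<Sum>s<2 * n. e s)"
      using e_0 by (intro sum.mono_neutral_right) auto
    finally show ?thesis .
  qed
  have "delta w Y u \<le> (\<Sum>y\<in>Y. \<Sum>k<3. e (T y + k))"
    unfolding delta_def by (rule sum_mono) (rule visit)
  \<comment> \<open>Different opponents are visited on different days, so for each of the three
    offsets an edge is charged at most once. This is the factor 3.\<close>
  also have "\<dots> = (\<Sum>k<3. \<Sum>t\<in>T ` Y. e (t + k))"
    by (subst sum.swap) (simp add: sum.reindex[OF T_inj])
  also have "\<dots> \<le> (\<Sum>k<(3::nat). \<Sum>t<2 * n. e (t + k))"
    using T e_nonneg by (intro sum_mono sum_mono2) auto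
  also have "\<dots> \<le> (\<Sum>k<(3::nat). \<Sum>s<2 * n. e s)"
    by (intro sum_mono shift)
  also have "\<dots> = 3 * (\<Sum>s<2 * n. e s)"
    by simp
  also have "(\<Sum>s<2 * n. e s) \<le> travel n w G u"
  proof -
    obtain N where N: "2 * n = Suc N"
      using \<open>0 < n\<close> by (metis Suc_pred nat_0_less_mult_iff pos2)
    have "0 \<le> w u (pos 0)"
      using nonneg u pos_in by blast
    then show ?thesis
      using N by (simp add: travel_def e_def pos_def)
  qed
  finally show ?thesis
    by simp
qed

definition total_weight :: "('a \<Rightarrow> 'a \<Rightarrow> real) \<Rightarrow> 'a set \<Rightarrow> 'a set \<Rightarrow> real" where
  "total_weight w X Y = (\<Sum>x\<in>X. delta w Y x)"

lemma total_weight_commute: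
  assumes "bttp_instance n X Y w"
  shows "total_weight w Y X = total_weight w X Y"
  unfolding total_weight_def delta_def
  by (subst sum.swap) (use assms in \<open>auto simp: bttp_instance_def intro!: sum.cong\<close>)

lemma total_weight_nonneg: "bttp_instance n X Y w \<Longrightarrow> 0 \<le> total_weight w X Y"
  by (auto simp: total_weight_def delta_def bttp_instance_def intro!: sum_nonneg)

text \<open>Each league on its own travels at least a third of the total weight.\<close>

lemma total_weight_le_schedule_weight:
  assumes inst: "bttp_instance n X Y w" and feas: "feasible n X Y G" and "0 < n"
  shows "2 * total_weight w X Y \<le> 3 * schedule_weight n X Y w G"
proof -
  have "total_weight w X Y \<le> (\<Sum>x\<in>X. 3 * travel n w G x)"
    unfolding total_weight_def by (intro sum_mono delta_le_travel[OF inst feas]) (auto simp: \<open>0 < n\<close>)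
  moreover have "total_weight w Y X \<le> (\<Sum>y\<in>Y. 3 * travel n w G y)"
    unfolding total_weight_def
    by (intro sum_mono delta_le_travel[OF bttp_instance_commute[OF inst] feasible_commute[OF feas]])
      (auto simp: \<open>0 < n\<close>)
  moreover have "schedule_weight n X Y w G = (\<Sum>x\<in>X. travel n w G x) + (\<Sum>y\<in>Y. travel n w G y)"
    unfolding schedule_weight_def
    using inst by (intro sum.union_disjoint) (auto simp: bttp_instance_def)
  ultimately show ?thesis
    using total_weight_commute[OF inst] by (simp add: sum_distrib_left[symmetric])
qed

text \<open>The given feasible schedule keeps the infimum from ranging over the empty set.\<close>

lemma total_weight_le_OPT:
  assumes "bttp_instance n X Y w" "0 < n" "feasible n X Y G"
  shows "2 / 3 * total_weight w X Y \<le> OPT n X Y w"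
  unfolding OPT_def
  using total_weight_le_schedule_weight[OF assms(1) _ assms(2)] assms(3)
  by (intro cINF_greatest) fastforce+

text \<open>Comparing every team outside \<open>U\<close> with every team inside shows that the
  outside has the smaller average degree. The product form avoids a division by
  \<open>card X\<close>.\<close>

lemma sum_low_teams_le:
  assumes "largest_teams k w Z X U" "finite X"
  shows "real (card X) * (\<Sum>v\<in>X - U. delta w Z v)
    \<le> real (card X - k) * (\<Sum>u\<in>X. delta w Z u)"
proof -
  have U: "U \<subseteq> X" "card U = k" "finite U"
    using assms finite_subset by (auto simp: largest_teams_def)
  have card_diff: "card (X - U) = card X - k"
    using U by (simp add: card_Diff_subset)
  have le: "k \<le> card X"
    using U assms(2) card_mono by blast
  have "real k * (\<Sum>v\<in>X - U. delta w Z v) = (\<Sum>u\<in>U. \<Sum>v\<in>X - U. delta w Z v)"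
    using U by simp
  also have "\<dots> \<le> (\<Sum>u\<in>U. \<Sum>v\<in>X - U. delta w Z u)"
    using assms(1) by (intro sum_mono) (auto simp: largest_teams_def)
  also have "\<dots> = real (card X - k) * (\<Sum>u\<in>U. delta w Z u)"
    by (simp add: card_diff sum_distrib_left)
  finally have *: "real k * (\<Sum>v\<in>X - U. delta w Z v) \<le> real (card X - k) * (\<Sum>u\<in>U. delta w Z u)" .
  have "(\<Sum>u\<in>X. delta w Z u) = (\<Sum>v\<in>X - U. delta w Z v) + (\<Sum>u\<in>U. delta w Z u)"
    using sum.subset_diff[OF U(1) assms(2)] .
  then show ?thesis
    using * le by (simp add: of_nat_diff algebra_simps)
qed

lemma low_weight_le:
  assumes inst: "bttp_instance n X Y w"
    and "largest_teams k w Y X U" "largest_teams k w X Y V"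
  shows "real n * low_weight w X Y U V \<le> 2 * real (n - k) * total_weight w X Y"
proof -
  have "finite X" "finite Y" "card X = n" "card Y = n"
    using inst by (auto simp: bttp_instance_def)
  then have "real n * (\<Sum>x\<in>X - U. delta w Y x) \<le> real (n - k) * total_weight w X Y"
    "real n * (\<Sum>y\<in>Y - V. delta w X y) \<le> real (n - k) * total_weight w Y X"
    using sum_low_teams_le[OF assms(2)] sum_low_teams_le[OF assms(3)]
    by (simp_all add: total_weight_def)
  then show ?thesis
    using total_weight_commute[OF inst] by (simp add: low_weight_def distrib_left)
qed

section \<open>Averaging over cyclic shifts of the paths\<close>

lemma bij_betw_add_mod: "bij_betw (\<lambda>p. (p + s) mod M) {..<M} {..<M :: nat}"
proof -
  have "inj_on (\<lambda>p. (p + s) mod M) {..<M}"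
  proof (rule linorder_inj_onI')
    fix p q assume *: "p \<in> {..<M}" "q \<in> {..<M}" "p < q"
    then show "(p + s) mod M \<noteq> (q + s) mod M"
      using mod_eq_dvd_iff_nat[of "p + s" "q + s" M] nat_dvd_not_less[of "q - p" M] by auto
  qed
  moreover have "(\<lambda>p. (p + s) mod M) ` {..<M} \<subseteq> {..<M}"
    by auto
  ultimately show ?thesis
    using endo_inj_surj[of "{..<M}"] by (simp add: bij_betw_def)
qed

text \<open>Two shifts move \<open>i\<close> to places that differ by \<open>3 * (s' - s)\<close>,
  which is positive and below \<open>3 * M\<close>.\<close>

lemma inj_on_path_shift: "inj_on (\<lambda>s. (i + 3 * s) mod (3 * M)) {..<M :: nat}"
proof (rule linorder_inj_onI')
  fix s s' :: nat
  assume *: "s \<in> {..<M}" "s' \<in> {..<M}" "s < s'"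
  show "(i + 3 * s) mod (3 * M) \<noteq> (i + 3 * s') mod (3 * M)"
  proof
    assume "(i + 3 * s) mod (3 * M) = (i + 3 * s') mod (3 * M)"
    then have "3 * M dvd (i + 3 * s') - (i + 3 * s)"
      using mod_eq_dvd_iff_nat[of "i + 3 * s" "i + 3 * s'" "3 * M"] * by simp
    then have "3 * M dvd 3 * (s' - s)"
      by (simp add: diff_mult_distrib2)
    then show False
      using * by (simp add: nat_dvd_not_less)
  qed
qed

text \<open>A fixed opponent meets a different partner under each shift, and different
  \<open>i\<close> have different opponents. So over all shifts together each pair is counted at
  most once.\<close>

lemma (in grouping) sum_shifted_day_le:
  fixes h :: "nat \<Rightarrow> nat \<Rightarrow> real"
  assumes nonneg: "\<And>i j. i < 3 * M \<Longrightarrow> j < 3 * M \<Longrightarrow> 0 \<le> h i j" and le: "3 * M \<le> n"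
  shows "(\<Sum>s<M. \<Sum>i<n. if i < 3 * M \<and> opp t i < 3 * M then h ((i + 3 * s) mod (3 * M)) (opp t i) else 0)
    \<le> (\<Sum>i<3 * M. \<Sum>j<3 * M. h i j)"
proof -
  have shift: "(\<Sum>s<M. h ((i + 3 * s) mod (3 * M)) j) \<le> (\<Sum>k<3 * M. h k j)"
    if "j < 3 * M" for i j
  proof -
    have "(\<Sum>s<M. h ((i + 3 * s) mod (3 * M)) j)
        = (\<Sum>k\<in>(\<lambda>s. (i + 3 * s) mod (3 * M)) ` {..<M}. h k j)"
      using inj_on_path_shift by (simp add: sum.reindex)
    also have "\<dots> \<le> (\<Sum>k<3 * M. h k j)"
      using that nonneg by (intro sum_mono2) auto
    finally show ?thesis .
  qed
  have "(\<Sum>s<M. \<Sum>i<n. if i < 3 * M \<and> opp t i < 3 * M then h ((i + 3 * s) mod (3 * M)) (opp t i) else 0)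
      = (\<Sum>i<n. \<Sum>s<M. if i < 3 * M \<and> opp t i < 3 * M then h ((i + 3 * s) mod (3 * M)) (opp t i) else 0)"
    by (rule sum.swap)
  also have "\<dots> \<le> (\<Sum>i<n. if opp t i < 3 * M then \<Sum>k<3 * M. h k (opp t i) else 0)"
  proof (rule sum_mono)
    fix i assume "i \<in> {..<n}"
    show "(\<Sum>s<M. if i < 3 * M \<and> opp t i < 3 * M then h ((i + 3 * s) mod (3 * M)) (opp t i) else 0)
        \<le> (if opp t i < 3 * M then \<Sum>k<3 * M. h k (opp t i) else 0)"
      using shift[of "opp t i" i] nonneg by (cases "i < 3 * M") (auto intro!: sum_nonneg)
  qed
  also have "\<dots> = (\<Sum>j<n. if j < 3 * M then \<Sum>k<3 * M. h k j else 0)"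
    using sum.reindex_bij_betw[OF bij_betw_opp] .
  also have "\<dots> = (\<Sum>j<3 * M. \<Sum>k<3 * M. h k j)"
    using sum_lessThan_split[OF le, of "\<lambda>j. if j < 3 * M then \<Sum>k<3 * M. h k j else 0"] by simp
  also have "\<dots> = (\<Sum>i<3 * M. \<Sum>j<3 * M. h i j)"
    by (rule sum.swap)
  finally show ?thesis .
qed


section \<open>Group numbers\<close>

text \<open>The \<open>M\<close> paths and \<open>n - 3 * M\<close> single teams would form
  \<open>n - 2 * M\<close> groups; for \<open>n > 2 * M\<close> this is the largest odd number not
  above that.\<close>

definition group_count :: "nat \<Rightarrow> nat \<Rightarrow> nat" where
  "group_count n M = 2 * ((n - 2 * M - 1) div 2) + 1"

text \<open>The teams behind the last path form groups of one team each, except that the first of these groups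
  absorbs a second team when that is needed to make the number of groups odd.\<close>

definition group_of :: "nat \<Rightarrow> nat \<Rightarrow> nat \<Rightarrow> nat" where
  "group_of n M i = i div 3 + ((i - (n - group_count n M)) - i div 3)"

lemma group_count_bounds:
  assumes "3 * M + 3 \<le> n"
  shows "group_count n M + 2 * M \<le> n" and "n \<le> group_count n M + 2 * M + 1"
proof -
  define k where "k = n - 2 * M - 1"
  have "k + 2 * M + 1 = n" "2 * (k div 2) \<le> k" "k \<le> 2 * (k div 2) + 1"
    using assms by (simp_all add: k_def)
  then show "group_count n M + 2 * M \<le> n" "n \<le> group_count n M + 2 * M + 1"
    unfolding group_count_def k_def[symmetric] by linarith+
qed

lemma group_of_path:
  assumes "3 * M + 3 \<le> n" "i < 3 * M"
  shows "group_of n M i = i div 3"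
proof -
  have "2 * M \<le> n - group_count n M"
    using group_count_bounds[OF assms(1)] by simp
  then show ?thesis
    using assms by (simp add: group_of_def)
qed

lemma grouping_group_of:
  assumes "3 * M + 3 \<le> n"
  shows "grouping n (group_count n M) (group_of n M)"
proof -
  define P where "P = group_count n M"
  have P: "odd P" "n \<le> P + 2 * M + 1" "P + 2 * M \<le> n"
    using group_count_bounds[OF assms] by (auto simp: P_def group_count_def)
  define c where "c = n - P"
  have c: "P + c = n"
    using P assms by (simp add: c_def)
  \<comment> \<open>Under truncated subtraction the formula is a maximum, of slope one third along
    the paths and of slope one behind them. Program expressions have no conditional.\<close>
  have group_of_eq: "group_of n M i = max (i div 3) (i - c)" for i
  proof -
    have "a + (b - a) = max a b" for a b :: nat
      by simp
    then show ?thesis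
      unfolding group_of_def c_def P_def .
  qed
  show ?thesis
    unfolding P_def[symmetric]
  proof unfold_locales
    have "n - 1 - c = P - 1" "3 * ((n - 1) div 3) \<le> n - 1"
      using c by auto
    then have "Suc (n - 1 - c) = P" "(n - 1) div 3 \<le> n - 1 - c"
      using P assms by linarith+
    then show "Suc (group_of n M (n - 1)) = P"
      by (simp add: group_of_eq)
    show "group_of n M (Suc i) = group_of n M i \<or> group_of n M (Suc i) = Suc (group_of n M i)" for i
    proof -
      have "Suc i div 3 = i div 3 \<or> Suc i div 3 = Suc (i div 3)" "Suc i - c = i - c \<or> Suc i - c = Suc (i - c)"
        by (auto simp: div_Suc)
      then show ?thesis
        unfolding group_of_eq by (elim disjE) (simp_all add: max_def)
    qed
    show "group_of n M i < group_of n M (i + 3)" for i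
    proof -
      have "(i + 3) div 3 = Suc (i div 3)"
        by simp
      then show ?thesis
        unfolding group_of_eq by (auto simp: max_def)
    qed
  qed (use assms P in \<open>auto simp: group_of_eq\<close>)
qed


section \<open>Total correctness of deterministic programs\<close>

text \<open>Covers only steps with a single outcome; the random draw is treated separately.
  Excluding \<open>Skip\<close> allows a run to be lifted into the first component of
  \<open>Seq\<close>.\<close>

inductive reach :: "nat \<Rightarrow> nat \<Rightarrow> com \<Rightarrow> memory \<Rightarrow> com \<Rightarrow> memory \<Rightarrow> bool" for W where
  reach_0: "reach W 0 c s c s"
| reach_Suc: "c \<noteq> Skip \<Longrightarrow> step W c s = return_pmf (c', s') \<Longrightarrow> reach W T c' s' c'' s''
    \<Longrightarrow> reach W (Suc T) c s c'' s''"

text \<open>\<open>run\<close> appends steps at the end, whereas executions are followed from the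
  beginning.\<close>

lemma run_Suc_first: "run W (Suc T) c s = step W c s \<bind> (\<lambda>(c', s'). run W T c' s')"
proof (induction T arbitrary: c s)
  case 0
  show ?case
    by (simp add: bind_return_pmf case_prod_unfold bind_return_pmf')
next
  case (Suc T)
  have "run W (Suc (Suc T)) c s
      = (step W c s \<bind> (\<lambda>(c', s'). run W T c' s')) \<bind> (\<lambda>(c', s'). step W c' s')"
    by (subst Suc.IH[symmetric]) simp
  also have "\<dots> = step W c s \<bind> (\<lambda>(c', s'). run W (Suc T) c' s')"
    by (simp add: bind_assoc_pmf case_prod_unfold)
  finally show ?case .
qed

lemma run_Skip: "run W T Skip s = return_pmf (Skip, s)"
  by (induction T) (auto simp: bind_return_pmf)

text \<open>A halted program remains at \<open>Skip\<close>, so an upper bound on the running time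
  suffices to know the result.\<close>

lemma run_if_reach: "reach W T c s Skip s' \<Longrightarrow> T \<le> T' \<Longrightarrow> run W T' c s = return_pmf (Skip, s')"
proof (induction T c s Skip s' arbitrary: T' rule: reach.induct)
  case (reach_Suc c s c' s' T s'')
  then obtain U where "T' = Suc U" "T \<le> U"
    by (cases T') auto
  then show ?case
    using reach_Suc by (simp add: run_Suc_first bind_return_pmf del: run.simps)
qed (simp add: run_Skip)

lemma reach_trans:
  "reach W T c s c' s' \<Longrightarrow> reach W U c' s' c'' s'' \<Longrightarrow> reach W (T + U) c s c'' s''"
  by (induction rule: reach.induct) (auto intro: reach.intros)

lemma reach_Seq: "reach W T c s c' s' \<Longrightarrow> reach W T (Seq c d) s (Seq c' d) s'"
  by (induction rule: reach.induct) (auto intro: reach.intros)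

text \<open>Total correctness with a time bound; since \<open>Skip\<close> is reached, no
  instruction gets stuck.\<close>

definition hoare ::
  "nat \<Rightarrow> (memory \<Rightarrow> bool) \<Rightarrow> com \<Rightarrow> nat \<Rightarrow> (memory \<Rightarrow> bool) \<Rightarrow> bool" where
  "hoare W P c T Q \<longleftrightarrow>
     (\<forall>s. P s \<longrightarrow> (\<exists>T' s'. T' \<le> T \<and> reach W T' c s Skip s' \<and> Q s'))"

lemma hoare_mono: "hoare W P c T Q \<Longrightarrow> T \<le> T' \<Longrightarrow> hoare W P c T' Q"
  unfolding hoare_def by (meson order_trans)

lemma hoare_Seq:
  assumes "hoare W P c T Q" "hoare W Q d U R"
  shows "hoare W P (Seq c d) (T + U + 1) R"
  unfolding hoare_def
proof (intro allI impI)
  fix s assume "P s"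
  then obtain T' s' where 1: "T' \<le> T" "reach W T' c s Skip s'" "Q s'"
    using assms(1) by (auto simp: hoare_def)
  then obtain U' s'' where 2: "U' \<le> U" "reach W U' d s' Skip s''" "R s''"
    using assms(2) unfolding hoare_def by blast
  have "reach W (Suc U') (Seq Skip d) s' Skip s''"
    by (rule reach_Suc[OF _ _ 2(2)]) simp_all
  then have "reach W (T' + Suc U') (Seq c d) s Skip s''"
    by (rule reach_trans[OF reach_Seq[OF 1(2)]])
  then show "\<exists>T' s'. T' \<le> T + U + 1 \<and> reach W T' (Seq c d) s Skip s' \<and> R s'"
    using 1 2 by (intro exI[of _ "T' + Suc U'"] exI[of _ s'']) auto
qed

text \<open>The invariant is indexed by the number of finished rounds. Each round costs one unit for
  the test and one for leaving the body; the failing test at the end costs one more.\<close>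

lemma hoare_While:
  assumes body: "\<And>k. k < N \<Longrightarrow> hoare W (I k) c T (I (Suc k))"
    and cond: "\<And>k s. k \<le> N \<Longrightarrow> I k s \<Longrightarrow> bval b s \<longleftrightarrow> k < N"
  shows "hoare W (I 0) (While b c) (N * (T + 2) + 1) (I N)"
proof -
  have "hoare W (I k) (While b c) ((N - k) * (T + 2) + 1) (I N)" if "k \<le> N" for k
    using that
  proof (induction rule: inc_induct)
    case base
    show ?case
      unfolding hoare_def
    proof (intro allI impI)
      fix s assume "I N s"
      then have "reach W 1 (While b c) s Skip s"
        using cond[of N s] reach_Suc[OF _ _ reach_0] by simp
      then show "\<exists>T' s'. T' \<le> (N - N) * (T + 2) + 1 \<and> reach W T' (While b c) s Skip s' \<and> I N s'"
        using \<open>I N s\<close> by (intro exI[of _ 1] exI[of _ s]) simp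
    qed
  next
    case (step k)
    have "N - k = Suc (N - Suc k)"
      using step by simp
    then have cost: "(N - k) * (T + 2) + 1 = Suc (T + ((N - Suc k) * (T + 2) + 1) + 1)"
      by simp
    have "hoare W (I k) (Seq c (While b c)) (T + ((N - Suc k) * (T + 2) + 1) + 1) (I N)"
      using step by (intro hoare_Seq[OF body])
    then show ?case
      unfolding cost hoare_def
    proof (intro allI impI)
      fix s assume "I k s"
      assume loop: "\<forall>s. I k s \<longrightarrow> (\<exists>T' s'. T' \<le> T + ((N - Suc k) * (T + 2) + 1) + 1
        \<and> reach W T' (Seq c (While b c)) s Skip s' \<and> I N s')"
      from loop \<open>I k s\<close> obtain T' s' where *: "T' \<le> T + ((N - Suc k) * (T + 2) + 1) + 1"
        "reach W T' (Seq c (While b c)) s Skip s'" "I N s'"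
        by blast
      have "reach W (Suc T') (While b c) s Skip s'"
        using cond[of k s] step \<open>I k s\<close> reach_Suc[OF _ _ *(2)] by simp
      then show "\<exists>T' s'. T' \<le> Suc (T + ((N - Suc k) * (T + 2) + 1) + 1)
        \<and> reach W T' (While b c) s Skip s' \<and> I N s'"
        using * by (intro exI[of _ "Suc T'"] exI[of _ s']) auto
    qed
  qed
  from this[of 0] show ?thesis by simp
qed

section \<open>Straight-line code and counting loops\<close>

text \<open>Intended for straight-line integer code; \<open>False\<close> for the other commands
  makes \<open>hoare_wp\<close> vacuous there.\<close>

primrec wp :: "nat \<Rightarrow> com \<Rightarrow> (memory \<Rightarrow> bool) \<Rightarrow> memory \<Rightarrow> bool" where
  "wp W Skip Q s = Q s"
| "wp W (Store a i e) Q s \<longleftrightarrow> nval i s < W \<and> nval e s < W \<and> Q (store a (nval i s) (nval e s) s)"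
| "wp W (RStore a i e) Q s = False"
| "wp W (Rand a i e) Q s = False"
| "wp W (Seq c d) Q s = wp W c (wp W d Q) s"
| "wp W (If b c d) Q s = False"
| "wp W (While b c) Q s = False"

primrec cost :: "com \<Rightarrow> nat" where
  "cost Skip = 0"
| "cost (Store a i e) = 1"
| "cost (RStore a i e) = 1"
| "cost (Rand a i e) = 1"
| "cost (Seq c d) = cost c + cost d + 1"
| "cost (If b c d) = 0"
| "cost (While b c) = 0"

lemma hoare_wp: "hoare W (wp W c Q) c (cost c) Q"
proof (induction c arbitrary: Q)
  case Skip
  show ?case
    by (auto simp: hoare_def intro: reach_0)
next
  case (Store a i e)
  show ?case
    unfolding hoare_def
  proof (intro allI impI)
    fix s assume *: "wp W (Store a i e) Q s"
    then have "reach W 1 (Store a i e) s Skip (store a (nval i s) (nval e s) s)"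
      using reach_Suc[OF _ _ reach_0] by simp
    then show "\<exists>T' s'. T' \<le> cost (Store a i e) \<and> reach W T' (Store a i e) s Skip s' \<and> Q s'"
      using * by (intro exI[of _ 1] exI) auto
  qed
next
  case (Seq c d)
  show ?case
    using hoare_Seq[OF Seq.IH(1) Seq.IH(2)] by (simp add: hoare_def)
qed (auto simp: hoare_def)

lemma hoare_straight: "(\<And>s. P s \<Longrightarrow> wp W c Q s) \<Longrightarrow> hoare W P c (cost c) Q"
  using hoare_wp[of W c Q] unfolding hoare_def by blast

abbreviation Var :: "name \<Rightarrow> nexp" where
  "Var x \<equiv> Load x (Const 0)"

abbreviation Assign :: "name \<Rightarrow> nexp \<Rightarrow> com" where
  "Assign x e \<equiv> Store x (Const 0) e"

definition count_loop :: "name \<Rightarrow> nexp \<Rightarrow> com \<Rightarrow> com" where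
  "count_loop x e c =
     Seq (Assign x (Const 0)) (While (Less (Var x) e) (Seq c (Assign x (Plus (Var x) (Const 1)))))"

lemma ints_store [simp]:
  "ints (store a i v s) b = (if b = a then (ints s a)(i := v) else ints s b)"
  by (simp add: store_def)

text \<open>Besides \<open>cost c\<close>, a round takes the increment, its sequencing and the two
  units of \<open>hoare_While\<close>. The final 3 are the initialisation, its sequencing and the
  failing test.\<close>

lemma hoare_count_loop:
  assumes init: "\<And>s. P s \<Longrightarrow> I 0 (store x 0 0 s)"
    and counter: "\<And>k s. k \<le> N \<Longrightarrow> I k s \<Longrightarrow> ints s x 0 = k \<and> nval e s = N"
    and body: "\<And>k s. k < N \<Longrightarrow> I k s \<Longrightarrow> wp W c (wp W (Assign x (Plus (Var x) (Const 1))) (I (Suc k))) s"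
    and W: "0 < W"
  shows "hoare W P (count_loop x e c) (N * (cost c + 4) + 3) (I N)"
proof -
  have 1: "hoare W P (Assign x (Const 0)) 1 (I 0)"
    using hoare_straight[of P W "Assign x (Const 0)" "I 0"] init W by simp
  have 2: "hoare W (I 0) (While (Less (Var x) e) (Seq c (Assign x (Plus (Var x) (Const 1)))))
      (N * (cost c + 1 + 1 + 2) + 1) (I N)"
  proof (rule hoare_While)
    show "hoare W (I k) (Seq c (Assign x (Plus (Var x) (Const 1)))) (cost c + 1 + 1) (I (Suc k))"
      if "k < N" for k
      using hoare_straight[of "I k" W "Seq c (Assign x (Plus (Var x) (Const 1)))" "I (Suc k)"]
        body[OF that] by simp
  qed (use counter in auto)
  show ?thesis
    unfolding count_loop_def by (rule hoare_mono[OF hoare_Seq[OF 1 2]]) (simp add: algebra_simps)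
qed


section \<open>The scheduling program\<close>

text \<open>This is \<open>m * d\<close> for the \<open>m\<close> of the theorem, the number of
  paths in a packing of \<open>3 * m * d\<close> teams.\<close>

definition path_count :: "nat \<Rightarrow> nat \<Rightarrow> nat" where
  "path_count d n = (2 * (n div (6 * d)) - 1) * d"

text \<open>Has constant size for constant \<open>d\<close>, so it can be evaluated anew within any
  single instruction.\<close>

definition path_count_exp :: "nat \<Rightarrow> nexp" where
  "path_count_exp d =
     Times (Minus (Times (Const 2) (Div (Var ''n'') (Const (6 * d)))) (Const 1)) (Const d)"

definition group_count_exp :: "nat \<Rightarrow> nexp" where
  "group_count_exp d =
     Plus (Times (Const 2)
       (Div (Minus (Minus (Var ''n'') (Times (Const 2) (path_count_exp d))) (Const 1)) (Const 2)))
     (Const 1)"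

definition group_exp :: "nat \<Rightarrow> nexp \<Rightarrow> nexp" where
  "group_exp d e =
     Plus (Div e (Const 3))
       (Minus (Minus e (Minus (Var ''n'') (group_count_exp d))) (Div e (Const 3)))"

text \<open>Output cell \<open>i\<close> belongs to game \<open>i mod n\<close> of day
  \<open>i div n\<close>; for this game and day the value is the argument of \<open>level\<close> in
  \<open>rank\<close>.\<close>

definition position_exp :: nexp where
  "position_exp = Minus (Plus (Div (Var ''i'') (Var ''n'')) (Var ''n'')) (Mod (Var ''i'') (Var ''n''))"

definition side_exp :: "nat \<Rightarrow> nexp" where
  "side_exp d =
     Mod (Plus (group_exp d (Mod (Var ''i'') (Var ''n'')))
       (Plus (group_exp d (Mod position_exp (Var ''n'')))
         (Times (group_count_exp d) (Div position_exp (Var ''n''))))) (Const 2)"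

definition side :: "nat \<Rightarrow> nat \<Rightarrow> nat \<Rightarrow> nat \<Rightarrow> nat" where
  "side n M t i =
     (group_of n M i + (group_of n M ((t + n - i) mod n)
       + group_count n M * ((t + n - i) div n))) mod 2"

lemma nval_path_count_exp: "nval (path_count_exp d) s = path_count d (ints s ''n'' 0)"
  by (simp add: path_count_exp_def path_count_def)

lemma nval_group_count_exp:
  "nval (group_count_exp d) s = group_count (ints s ''n'' 0) (path_count d (ints s ''n'' 0))"
  by (simp add: group_count_exp_def group_count_def nval_path_count_exp)

lemma nval_group_exp:
  "nval (group_exp d e) s = group_of (ints s ''n'' 0) (path_count d (ints s ''n'' 0)) (nval e s)"
  by (simp add: group_exp_def group_of_def nval_group_count_exp)

lemma nval_position_exp:
  "nval position_exp s
     = ints s ''i'' 0 div ints s ''n'' 0 + ints s ''n'' 0 - ints s ''i'' 0 mod ints s ''n'' 0"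
  by (simp add: position_exp_def)

lemma nval_side_exp:
  "nval (side_exp d) s
     = side (ints s ''n'' 0) (path_count d (ints s ''n'' 0))
         (ints s ''i'' 0 div ints s ''n'' 0) (ints s ''i'' 0 mod ints s ''n'' 0)"
  by (simp add: side_exp_def side_def nval_group_exp nval_group_count_exp nval_position_exp)

text \<open>The random number in array \<open>s\<close> rotates the paths of \<open>X\<close> as
  whole paths, while those of \<open>Y\<close> keep their order. The marks record which teams are
  already placed.\<close>

definition load_paths :: "nat \<Rightarrow> com" where
  "load_paths d = count_loop ''i'' (Times (Const 3) (path_count_exp d))
     (Seq (Store ''ax'' (Var ''i'')
        (Load ''px'' (Mod (Plus (Var ''i'') (Times (Const 3) (Var ''s'')))
          (Times (Const 3) (path_count_exp d)))))
     (Seq (Store ''ay'' (Var ''i'') (Load ''py'' (Var ''i'')))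
     (Seq (Store ''mark'' (Load ''ax'' (Var ''i'')) (Const 1))
       (Store ''mark'' (Load ''ay'' (Var ''i'')) (Const 1)))))"

text \<open>Every team is written to the end of its list, but a marked team, being on the list already,
  is overwritten by the next one.\<close>

definition append_rest :: com where
  "append_rest = count_loop ''i'' (Var ''n'')
     (Seq (Store ''ax'' (Var ''cx'') (Var ''i''))
     (Seq (Assign ''cx'' (Plus (Var ''cx'') (Minus (Const 1) (Load ''mark'' (Var ''i'')))))
     (Seq (Store ''ay'' (Var ''cy'') (Plus (Var ''n'') (Var ''i'')))
       (Assign ''cy''
         (Plus (Var ''cy'') (Minus (Const 1) (Load ''mark'' (Plus (Var ''n'') (Var ''i'')))))))))"

text \<open>Expressions have no conditional, so the bit computed by \<open>side_exp\<close> selects arithmetically.\<close>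

definition home_exp :: "nat \<Rightarrow> nexp" where
  "home_exp d =
     Plus (Times (Minus (Const 1) (side_exp d)) (Load ''ax'' (Mod (Var ''i'') (Var ''n''))))
       (Times (side_exp d) (Load ''ay'' (Mod position_exp (Var ''n''))))"

definition away_exp :: "nat \<Rightarrow> nexp" where
  "away_exp d =
     Plus (Times (side_exp d) (Load ''ax'' (Mod (Var ''i'') (Var ''n''))))
       (Times (Minus (Const 1) (side_exp d)) (Load ''ay'' (Mod position_exp (Var ''n''))))"

definition write_games :: "nat \<Rightarrow> com" where
  "write_games d = count_loop ''i'' (Times (Const 2) (Times (Var ''n'') (Var ''n'')))
     (Seq (Store ''home'' (Var ''i'') (home_exp d)) (Store ''away'' (Var ''i'') (away_exp d)))"

text \<open>What follows the random draw is deterministic, so time-bounded triples apply to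
  it.\<close>

definition scheduler_tail :: "nat \<Rightarrow> com" where
  "scheduler_tail d =
     Seq (load_paths d)
     (Seq (Seq (Assign ''cx'' (Times (Const 3) (path_count_exp d)))
             (Assign ''cy'' (Times (Const 3) (path_count_exp d))))
     (Seq append_rest (write_games d)))"

definition scheduler :: "nat \<Rightarrow> com" where
  "scheduler d = Seq (Rand ''s'' (Const 0) (path_count_exp d)) (scheduler_tail d)"

section \<open>Correctness of the program for a fixed random draw\<close>

locale scheduler_input =
  fixes d n :: nat and px py :: "nat \<Rightarrow> nat" and \<sigma> :: nat
  fixes M :: nat
  assumes M_def: "M = path_count d n"
    and M_le: "3 * M \<le> n" and n_ge_3: "3 \<le> n" and M_pos: "0 < M" and \<sigma>: "\<sigma> < M"
    and px: "inj_on px {..<3 * M}" "px ` {..<3 * M} \<subseteq> {..<n}"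
    and py: "inj_on py {..<3 * M}" "py ` {..<3 * M} \<subseteq> {n..<2 * n}"
begin

abbreviation "W \<equiv> n ^ 3"

definition qx :: "nat \<Rightarrow> nat" where
  "qx i = px ((i + 3 * \<sigma>) mod (3 * M))"

definition marked :: "nat \<Rightarrow> nat \<Rightarrow> nat" where
  "marked k v = (if v \<in> qx ` {..<k} \<union> py ` {..<k} then 1 else 0)"

text \<open>The output occupies \<open>2 * n * n\<close> cells, and \<open>n \<ge> 3\<close> puts
  this below the cubic word bound.\<close>

lemma W_bounds: "2 * (n * n) < W" "2 * n < W" "n < W" "0 < W" "Suc 0 < W"
proof -
  have "3 * (n * n) \<le> W"
    using n_ge_3 by (simp add: power3_eq_cube)
  moreover have "3 * n \<le> n * n"
    using n_ge_3 by simp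
  ultimately show "2 * (n * n) < W" "2 * n < W" "n < W" "0 < W" "Suc 0 < W"
    using n_ge_3 by linarith+
qed

lemma shift_less: "(i + 3 * \<sigma>) mod (3 * M) < 3 * M"
  using M_pos by simp

lemma qx_less: "qx i < n"
  using px(2) shift_less by (auto simp: qx_def)

lemma py_bounds: "i < 3 * M \<Longrightarrow> n \<le> py i \<and> py i < 2 * n"
  using py(2) by fastforce

lemma inj_on_qx: "inj_on qx {..<3 * M}"
proof -
  have "inj_on (\<lambda>i. (i + 3 * \<sigma>) mod (3 * M)) {..<3 * M}"
    using bij_betw_add_mod by (rule bij_betw_imp_inj_on)
  moreover have "inj_on px ((\<lambda>i. (i + 3 * \<sigma>) mod (3 * M)) ` {..<3 * M})"
    using px(1) by (rule inj_on_subset) (use shift_less in auto)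
  ultimately have "inj_on (px \<circ> (\<lambda>i. (i + 3 * \<sigma>) mod (3 * M))) {..<3 * M}"
    by (rule comp_inj_on)
  then show ?thesis
    by (simp add: comp_def qx_def[abs_def])
qed

definition loaded :: "nat \<Rightarrow> memory \<Rightarrow> bool" where
  "loaded k s \<longleftrightarrow> ints s ''n'' 0 = n \<and> ints s ''px'' = px \<and> ints s ''py'' = py \<and> ints s ''s'' 0 = \<sigma>
     \<and> ints s ''i'' 0 = k \<and> (\<forall>i<k. ints s ''ax'' i = qx i \<and> ints s ''ay'' i = py i)
     \<and> ints s ''mark'' = marked k"

text \<open>Only the first \<open>cx\<close> and \<open>cy\<close> cells belong to the rows; a
  marked team just written lies beyond them.\<close>

definition appended :: "nat \<Rightarrow> memory \<Rightarrow> bool" where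
  "appended k s \<longleftrightarrow> ints s ''n'' 0 = n \<and> ints s ''i'' 0 = k
     \<and> (\<forall>i<3 * M. ints s ''ax'' i = qx i \<and> ints s ''ay'' i = py i)
     \<and> ints s ''mark'' = marked (3 * M)
     \<and> 3 * M \<le> ints s ''cx'' 0 \<and> 3 * M \<le> ints s ''cy'' 0
     \<and> bij_betw (ints s ''ax'') {..<ints s ''cx'' 0} (qx ` {..<3 * M} \<union> {..<k})
     \<and> bij_betw (ints s ''ay'') {..<ints s ''cy'' 0} (py ` {..<3 * M} \<union> {n..<n + k})"

definition seeded :: "memory \<Rightarrow> bool" where
  "seeded s \<longleftrightarrow> ints s ''n'' 0 = n
     \<and> (\<forall>i<3 * M. ints s ''ax'' i = qx i \<and> ints s ''ay'' i = py i)
     \<and> bij_betw (ints s ''ax'') {..<n} {..<n} \<and> bij_betw (ints s ''ay'') {..<n} {n..<2 * n}"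

definition home_team :: "memory \<Rightarrow> nat \<Rightarrow> nat \<Rightarrow> nat" where
  "home_team s t i =
     (if side n M t i = 0 then ints s ''ax'' i else ints s ''ay'' ((t + n - i) mod n))"

definition away_team :: "memory \<Rightarrow> nat \<Rightarrow> nat \<Rightarrow> nat" where
  "away_team s t i =
     (if side n M t i = 0 then ints s ''ay'' ((t + n - i) mod n) else ints s ''ax'' i)"

definition written :: "nat \<Rightarrow> memory \<Rightarrow> bool" where
  "written k s \<longleftrightarrow> seeded s \<and> ints s ''i'' 0 = k
     \<and> (\<forall>z<k. ints s ''home'' z = home_team s (z div n) (z mod n)
            \<and> ints s ''away'' z = away_team s (z div n) (z mod n))"

definition start :: "memory \<Rightarrow> bool" where
  "start s \<longleftrightarrow> ints s ''n'' 0 = n \<and> ints s ''px'' = px \<and> ints s ''py'' = py \<and> ints s ''s'' 0 = \<sigma>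
     \<and> ints s ''mark'' = (\<lambda>_. 0)"

lemma hoare_load_paths: "hoare W start (load_paths d) (3 * M * 11 + 3) (loaded (3 * M))"
proof -
  have marked_Suc: "marked (Suc k) = (marked k)(qx k := 1, py k := 1)" for k
    by (auto simp: marked_def lessThan_Suc fun_eq_iff)
  show ?thesis
    unfolding load_paths_def
  proof (rule hoare_mono[OF hoare_count_loop[where N = "3 * M" and I = loaded]])
    show "loaded 0 (store ''i'' 0 0 s)" if "start s" for s
      using that by (simp add: start_def loaded_def marked_def fun_eq_iff)
    show "ints s ''i'' 0 = k \<and> nval (Times (Const 3) (path_count_exp d)) s = 3 * M"
      if "loaded k s" for k s
      using that by (simp add: loaded_def nval_path_count_exp M_def[symmetric])
    have qx_W: "qx k < W" for k
      using qx_less[of k] W_bounds by simp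
    have py_W: "py k < W" if "k < 3 * M" for k
      using py_bounds[OF that] W_bounds by simp
    show "wp W
        (Seq (Store ''ax'' (Var ''i'')
          (Load ''px'' (Mod (Plus (Var ''i'') (Times (Const 3) (Var ''s'')))
            (Times (Const 3) (path_count_exp d)))))
        (Seq (Store ''ay'' (Var ''i'') (Load ''py'' (Var ''i'')))
        (Seq (Store ''mark'' (Load ''ax'' (Var ''i'')) (Const 1))
          (Store ''mark'' (Load ''ay'' (Var ''i'')) (Const 1)))))
        (wp W (Assign ''i'' (Plus (Var ''i'') (Const 1))) (loaded (Suc k))) s"
      if "k < 3 * M" "loaded k s" for k s
      using that W_bounds M_le qx_W[of k] py_W[of k]
      by (auto simp: loaded_def marked_Suc less_Suc_eq nval_path_count_exp M_def[symmetric]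
          simp flip: qx_def)
  qed (use W_bounds in auto)
qed

lemma marked_eq: "k < n \<Longrightarrow> marked (3 * M) k = (if k \<in> qx ` {..<3 * M} then 1 else 0)"
  "marked (3 * M) (n + k) = (if n + k \<in> py ` {..<3 * M} then 1 else 0)"
proof -
  show "marked (3 * M) k = (if k \<in> qx ` {..<3 * M} then 1 else 0)" if "k < n"
    using that py_bounds by (force simp: marked_def)
  have "n + k \<notin> qx ` {..<3 * M}"
    using qx_less by (metis image_iff not_add_less1)
  then show "marked (3 * M) (n + k) = (if n + k \<in> py ` {..<3 * M} then 1 else 0)"
    by (auto simp: marked_def)
qed

text \<open>A team in \<open>F\<close> is listed already, so the write falls beyond the row and its
  length stays. Any other team extends the row by one cell.\<close>

lemma bij_betw_append:
  fixes c :: nat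
  assumes f: "bij_betw f {..<c} (F \<union> K)" and v: "v \<notin> K"
  shows "bij_betw (f(c := v)) {..<c + (1 - (if v \<in> F then 1 else 0))} (insert v (F \<union> K))"
proof -
  have "bij_betw (f(c := v)) {..<c} (F \<union> K) \<longleftrightarrow> bij_betw f {..<c} (F \<union> K)"
    by (rule bij_betw_cong) auto
  then have *: "bij_betw (f(c := v)) {..<c} (F \<union> K)"
    using f by simp
  show ?thesis
  proof (cases "v \<in> F")
    case False
    have "bij_betw (f(c := v)) ({..<c} \<union> {c}) ((F \<union> K) \<union> {v})"
      using * False v by (intro bij_betw_combine) (auto simp: bij_betw_def)
    then show ?thesis
      using False by (simp add: lessThan_Suc Un_commute)
  qed (use * in \<open>simp add: insert_absorb\<close>)
qed

text \<open>The postcondition anticipates the reset of the counter with which the next loop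
  begins.\<close>

lemma hoare_init_counters:
  "hoare W (loaded (3 * M))
     (Seq (Assign ''cx'' (Times (Const 3) (path_count_exp d)))
       (Assign ''cy'' (Times (Const 3) (path_count_exp d))))
     3 (\<lambda>s. appended 0 (store ''i'' 0 0 s))"
proof -
  have "bij_betw (ints s ''ax'') {..<3 * M} (qx ` {..<3 * M})"
    "bij_betw (ints s ''ay'') {..<3 * M} (py ` {..<3 * M})" if "loaded (3 * M) s" for s
  proof -
    have "bij_betw (ints s ''ax'') {..<3 * M} (qx ` {..<3 * M})
        \<longleftrightarrow> bij_betw qx {..<3 * M} (qx ` {..<3 * M})"
      "bij_betw (ints s ''ay'') {..<3 * M} (py ` {..<3 * M})
        \<longleftrightarrow> bij_betw py {..<3 * M} (py ` {..<3 * M})"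
      using that by (auto simp: loaded_def intro!: bij_betw_cong)
    then show "bij_betw (ints s ''ax'') {..<3 * M} (qx ` {..<3 * M})"
      "bij_betw (ints s ''ay'') {..<3 * M} (py ` {..<3 * M})"
      using inj_on_qx py(1) by (simp_all add: bij_betw_def)
  qed
  then have "wp W (Seq (Assign ''cx'' (Times (Const 3) (path_count_exp d)))
       (Assign ''cy'' (Times (Const 3) (path_count_exp d))))
       (\<lambda>s. appended 0 (store ''i'' 0 0 s)) s" if "loaded (3 * M) s" for s
    using that W_bounds M_le
    by (simp add: loaded_def appended_def nval_path_count_exp M_def[symmetric])
  then show ?thesis
    by (rule hoare_mono[OF hoare_straight]) simp_all
qed

text \<open>The rows list distinct teams of one league. This keeps the addresses written next below
  the word bound.\<close>

lemma appended_bounds: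
  assumes "appended k s" "k \<le> n"
  shows "ints s ''cx'' 0 \<le> n" "ints s ''cy'' 0 \<le> n"
proof -
  have "qx ` {..<3 * M} \<union> {..<k} \<subseteq> {..<n}"
    using qx_less assms(2) by auto
  then have "card (qx ` {..<3 * M} \<union> {..<k}) \<le> n"
    using card_mono[of "{..<n}"] by fastforce
  then show "ints s ''cx'' 0 \<le> n"
    using assms(1) bij_betw_same_card by (fastforce simp: appended_def)
  have "py ` {..<3 * M} \<union> {n..<n + k} \<subseteq> {n..<2 * n}"
    using py(2) assms(2) by auto
  then have "card (py ` {..<3 * M} \<union> {n..<n + k}) \<le> n"
    using card_mono[of "{n..<2 * n}"] by fastforce
  then show "ints s ''cy'' 0 \<le> n"
    using assms(1) bij_betw_same_card by (fastforce simp: appended_def)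
qed

lemma hoare_append_rest:
  "hoare W (\<lambda>s. appended 0 (store ''i'' 0 0 s)) append_rest (n * 11 + 3) (appended n)"
  unfolding append_rest_def
proof (rule hoare_mono[OF hoare_count_loop[where N = n and I = appended]])
  show "wp W
      (Seq (Store ''ax'' (Var ''cx'') (Var ''i''))
      (Seq (Assign ''cx'' (Plus (Var ''cx'') (Minus (Const 1) (Load ''mark'' (Var ''i'')))))
      (Seq (Store ''ay'' (Var ''cy'') (Plus (Var ''n'') (Var ''i'')))
        (Assign ''cy''
          (Plus (Var ''cy'') (Minus (Const 1) (Load ''mark'' (Plus (Var ''n'') (Var ''i'')))))))))
      (wp W (Assign ''i'' (Plus (Var ''i'') (Const 1))) (appended (Suc k))) s"
    if k: "k < n" and s: "appended k s" for k s
  proof -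
    define cx cy where "cx = ints s ''cx'' 0" and "cy = ints s ''cy'' 0"
    have "cx \<le> n" "cy \<le> n"
      using appended_bounds[OF s] k by (simp_all add: cx_def cy_def)
    then have bounds: "cx < W" "cy < W" "Suc cx < W" "Suc cy < W" "n + k < W" "Suc k < W" "k < W"
      using k W_bounds n_ge_3 by linarith+
    have "insert k (qx ` {..<3 * M} \<union> {..<k}) = qx ` {..<3 * M} \<union> {..<Suc k}"
      "insert (n + k) (py ` {..<3 * M} \<union> {n..<n + k}) = py ` {..<3 * M} \<union> {n..<n + Suc k}"
      by auto
    then have "bij_betw ((ints s ''ax'')(cx := k)) {..<cx + (1 - marked (3 * M) k)}
        (qx ` {..<3 * M} \<union> {..<Suc k})"
      "bij_betw ((ints s ''ay'')(cy := n + k)) {..<cy + (1 - marked (3 * M) (n + k))}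
        (py ` {..<3 * M} \<union> {n..<n + Suc k})"
      using bij_betw_append[of "ints s ''ax''" cx "qx ` {..<3 * M}" "{..<k}" k]
        bij_betw_append[of "ints s ''ay''" cy "py ` {..<3 * M}" "{n..<n + k}" "n + k"] s
      by (simp_all only: marked_eq k) (simp_all add: appended_def cx_def cy_def)
    then show ?thesis
      using s k bounds by (auto simp: appended_def simp flip: cx_def cy_def)
  qed
qed (use W_bounds in \<open>auto simp: appended_def\<close>)

lemma seeded_if_appended:
  assumes "appended n s"
  shows "seeded s"
proof -
  have "qx ` {..<3 * M} \<union> {..<n} = {..<n}" "py ` {..<3 * M} \<union> {n..<n + n} = {n..<2 * n}"
    using qx_less py(2) by (auto simp: mult_2)
  then have *: "bij_betw (ints s ''ax'') {..<ints s ''cx'' 0} {..<n}"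
    "bij_betw (ints s ''ay'') {..<ints s ''cy'' 0} {n..<2 * n}"
    using assms by (simp_all add: appended_def)
  then have "ints s ''cx'' 0 = n" "ints s ''cy'' 0 = n"
    using bij_betw_same_card[OF *(1)] bij_betw_same_card[OF *(2)] by simp_all
  then show ?thesis
    using assms * by (simp add: appended_def seeded_def)
qed

lemma choose_by_bit: "p < 2 \<Longrightarrow> (1 - p) * a + p * b = (if p = 0 then a else b)" for p a b :: nat
  by (cases "p = 0") (auto dest: less_2_cases)

lemma hoare_write_games:
  "hoare W (appended n) (write_games d) (2 * (n * n) * 7 + 3) (written (2 * (n * n)))"
  unfolding write_games_def
proof (rule hoare_mono[OF hoare_count_loop[where N = "2 * (n * n)" and I = written]])
  show "written 0 (store ''i'' 0 0 s)" if "appended n s" for s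
    using seeded_if_appended[OF that] by (simp add: written_def seeded_def)
  show "ints s ''i'' 0 = k \<and> nval (Times (Const 2) (Times (Var ''n'') (Var ''n''))) s = 2 * (n * n)"
    if "written k s" for k s
    using that by (simp add: written_def seeded_def)
  show "wp W (Seq (Store ''home'' (Var ''i'') (home_exp d)) (Store ''away'' (Var ''i'') (away_exp d)))
      (wp W (Assign ''i'' (Plus (Var ''i'') (Const 1))) (written (Suc k))) s"
    if k: "k < 2 * (n * n)" and s: "written k s" for k s
  proof -
    have side: "side n M t i < 2" for t i
      by (simp add: side_def)
    have exps: "nval (home_exp d) s' = home_team s' (k div n) (k mod n)"
      "nval (away_exp d) s' = away_team s' (k div n) (k mod n)"
      if "ints s' ''n'' 0 = n" "ints s' ''i'' 0 = k" for s'
      using choose_by_bit[OF side] that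
      by (simp_all add: home_exp_def away_exp_def home_team_def away_team_def nval_side_exp
          nval_position_exp M_def[symmetric] add.commute[of "side _ _ _ _ * _"])
    have "ints s ''ax'' (k mod n) < W" "ints s ''ay'' ((k div n + n - k mod n) mod n) < W"
    proof -
      have "k mod n < n" "(k div n + n - k mod n) mod n < n"
        using n_ge_3 by simp_all
      then have "ints s ''ax'' (k mod n) \<in> {..<n}"
        "ints s ''ay'' ((k div n + n - k mod n) mod n) \<in> {n..<2 * n}"
        using s by (auto simp: written_def seeded_def bij_betw_def)
      then show "ints s ''ax'' (k mod n) < W" "ints s ''ay'' ((k div n + n - k mod n) mod n) < W"
        using W_bounds by auto
    qed
    then have bounds: "home_team s (k div n) (k mod n) < W" "away_team s (k div n) (k mod n) < W"
      by (simp_all add: home_team_def away_team_def)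
    have frame: "home_team (store a i v s') = home_team s'" "away_team (store a i v s') = away_team s'"
      if "a \<noteq> ''ax''" "a \<noteq> ''ay''" for a i v s'
      using that by (auto simp: home_team_def away_team_def fun_eq_iff)
    show ?thesis
      using s k bounds W_bounds
      by (auto simp: written_def seeded_def exps frame less_Suc_eq)
  qed
qed (use W_bounds in auto)

lemma hoare_scheduler_tail:
  "hoare W start (scheduler_tail d) (66 * n\<^sup>2) (written (2 * (n * n)))"
proof -
  have "n \<le> n * n" "3 \<le> n * n"
    using n_ge_3 by (auto intro: order_trans)
  \<comment> \<open>Up to constants the three loops take at most \<open>22 * n + 14 * n * n\<close>
    steps, so 66 is generous.\<close>
  then have "3 * M * 11 + 3 + (3 + (n * 11 + 3 + (2 * (n * n) * 7 + 3) + 1) + 1) + 1 \<le> 66 * n\<^sup>2"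
    using M_le unfolding power2_eq_square by linarith
  then show ?thesis
    unfolding scheduler_tail_def
    by (rule hoare_mono[rotated])
      (rule hoare_Seq[OF hoare_load_paths hoare_Seq[OF hoare_init_counters
            hoare_Seq[OF hoare_append_rest hoare_write_games]]])
qed

end

text \<open>The shift is the only random choice, so the result is the image of a uniform shift under
  some map \<open>f\<close>, and expectations become averages over \<open>{..<M}\<close>.\<close>

lemma run_scheduler:
  assumes M: "M = path_count d n" "0 < M" "3 * M \<le> n" "3 \<le> n"
    and px: "inj_on px {..<3 * M}" "px ` {..<3 * M} \<subseteq> {..<n}"
    and py: "inj_on py {..<3 * M}" "py ` {..<3 * M} \<subseteq> {n..<2 * n}"
    and s: "ints s ''n'' 0 = n" "ints s ''px'' = px" "ints s ''py'' = py" "ints s ''mark'' = (\<lambda>_. 0)"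
  shows "\<exists>f. run (n ^ 3) (67 * n\<^sup>2) (scheduler d) s
      = map_pmf (\<lambda>\<sigma>. (Skip, f \<sigma>)) (pmf_of_set {..<M})
    \<and> (\<forall>\<sigma><M. scheduler_input.written n px py \<sigma> M (2 * (n * n)) (f \<sigma>))"
proof -
  have "\<exists>s'. run (n ^ 3) (67 * n\<^sup>2 - 2) (scheduler_tail d) (store ''s'' 0 \<sigma> s) = return_pmf (Skip, s')
      \<and> scheduler_input.written n px py \<sigma> M (2 * (n * n)) s'" if "\<sigma> < M" for \<sigma>
  proof -
    interpret scheduler_input d n px py \<sigma> M
      using assms that by unfold_locales auto
    have "start (store ''s'' 0 \<sigma> s)"
      using s by (simp add: start_def)
    then obtain T s' where *: "T \<le> 66 * n\<^sup>2"
      "reach W T (scheduler_tail d) (store ''s'' 0 \<sigma> s) Skip s'" "written (2 * (n * n)) s'"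
      using hoare_scheduler_tail by (auto simp: hoare_def)
    have "2 \<le> n\<^sup>2"
      using mult_le_mono[OF \<open>3 \<le> n\<close> \<open>3 \<le> n\<close>] by (simp add: power2_eq_square)
    then have "T \<le> 67 * n\<^sup>2 - 2"
      using * by linarith
    then show ?thesis
      using * run_if_reach by blast
  qed
  then obtain f where f: "\<And>\<sigma>. \<sigma> < M \<Longrightarrow>
      run (n ^ 3) (67 * n\<^sup>2 - 2) (scheduler_tail d) (store ''s'' 0 \<sigma> s) = return_pmf (Skip, f \<sigma>)"
    "\<And>\<sigma>. \<sigma> < M \<Longrightarrow> scheduler_input.written n px py \<sigma> M (2 * (n * n)) (f \<sigma>)"
    by metis
  have set: "set_pmf (pmf_of_set {..<M}) = {..<M}"
    using M by (intro set_pmf_of_set) auto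
  have "3 * M \<le> n ^ 3" "0 < n ^ 3"
    using M self_le_power[of n 3] by linarith+
  then have rand: "step (n ^ 3) (scheduler d) s
      = map_pmf (\<lambda>\<sigma>. (Seq Skip (scheduler_tail d), store ''s'' 0 \<sigma> s)) (pmf_of_set {..<M})"
    using M s by (simp add: scheduler_def nval_path_count_exp map_pmf_comp comp_def)
  have "2 \<le> n\<^sup>2"
    using mult_le_mono[OF \<open>3 \<le> n\<close> \<open>3 \<le> n\<close>] by (simp add: power2_eq_square)
  \<comment> \<open>The two units split off are the draw and the step that discards the finished
    draw.\<close>
  then have T: "67 * n\<^sup>2 = Suc (Suc (67 * n\<^sup>2 - 2))"
    by simp
  have "run (n ^ 3) (67 * n\<^sup>2) (scheduler d) s
      = pmf_of_set {..<M} \<bind> (\<lambda>\<sigma>. run (n ^ 3) (67 * n\<^sup>2 - 2) (scheduler_tail d) (store ''s'' 0 \<sigma> s))"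
    by (subst T) (simp add: run_Suc_first rand bind_map_pmf bind_return_pmf del: run.simps(2))
  also have "\<dots> = pmf_of_set {..<M} \<bind> (\<lambda>\<sigma>. return_pmf (Skip, f \<sigma>))"
    by (intro bind_pmf_cong refl) (simp add: set f(1))
  also have "\<dots> = map_pmf (\<lambda>\<sigma>. (Skip, f \<sigma>)) (pmf_of_set {..<M})"
    by (simp add: map_pmf_def)
  finally show ?thesis
    using f(2) by blast
qed


section \<open>The expected weight\<close>

definition flatten :: "('a \<times> 'a \<times> 'a) list \<Rightarrow> 'a list" where
  "flatten Q = concat (map (\<lambda>(a, b, c). [a, b, c]) Q)"

lemma length_flatten: "length (flatten Q) = 3 * length Q"
  by (induction Q) (auto simp: flatten_def)

lemma nth_flatten:
  "p < length Q \<Longrightarrow> Q ! p = (flatten Q ! (3 * p), flatten Q ! (3 * p + 1), flatten Q ! (3 * p + 2))"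
proof (induction Q arbitrary: p)
  case (Cons q Q)
  show ?case
    using Cons.prems Cons.IH[of "p - 1"]
    by (cases p; cases q) (auto simp: flatten_def)
qed simp

lemma set_flatten:
  assumes "three_path_packing V (set Q)"
  shows "set (flatten Q) = V"
proof -
  have "set (flatten Q) = (\<Union>p\<in>set Q. path_verts p)"
    by (auto simp: flatten_def)
  then show ?thesis
    using assms by (simp add: three_path_packing_def)
qed

lemma distinct_flatten:
  assumes "three_path_packing V (set Q)" "distinct Q"
  shows "distinct (flatten Q)"
  unfolding flatten_def
proof (rule distinct_concat)
  show "distinct (map (\<lambda>(a, b, c). [a, b, c]) Q)"
    using assms(2) by (auto simp: distinct_map inj_on_def)
  show "distinct ys" if "ys \<in> set (map (\<lambda>(a, b, c). [a, b, c]) Q)" for ys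
    using that assms(1) by (fastforce simp: three_path_packing_def)
  show "set ys \<inter> set zs = {}"
    if lists: "ys \<in> set (map (\<lambda>(a, b, c). [a, b, c]) Q)" "zs \<in> set (map (\<lambda>(a, b, c). [a, b, c]) Q)"
      "ys \<noteq> zs" for ys zs
  proof -
    obtain p q where pq: "p \<in> set Q" "q \<in> set Q"
      "ys = (\<lambda>(a, b, c). [a, b, c]) p" "zs = (\<lambda>(a, b, c). [a, b, c]) q"
      using lists(1,2) unfolding set_map by blast
    then have "path_verts p \<inter> path_verts q = {}"
      using assms(1) lists(3) unfolding three_path_packing_def by metis
    then show ?thesis
      using pq by (cases p; cases q) simp
  qed
qed

text \<open>Since \<open>r < 3\<close> is the place within a path, reduction modulo
  \<open>3 * M\<close> acts on the path number alone.\<close>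

lemma mod_path: "r < 3 \<Longrightarrow> (3 * p + r + 3 * s) mod (3 * M) = 3 * ((p + s) mod M) + r"
  for p r s M :: nat
proof -
  assume "r < 3"
  define q where "q = p + s"
  have "(r + 3 * q) mod (3 * M) = 3 * (q mod M) + r"
    using \<open>r < 3\<close> mod_mult2_eq[of "r + 3 * q" 3 M] by simp
  moreover have "3 * p + r + 3 * s = r + 3 * q"
    by (simp add: q_def)
  ultimately show ?thesis
    by (simp only: q_def)
qed

text \<open>The packing terms do not depend on the order of the paths, so it suffices that the
  rotated row enumerates the same set of triples.\<close>

lemma bij_betw_shifted_paths:
  assumes "distinct Q" "length Q = M"
    and A: "\<And>i. i < 3 * M \<Longrightarrow> A i = flatten Q ! ((i + 3 * s) mod (3 * M))"
  shows "bij_betw (\<lambda>p. (A (3 * p), A (3 * p + 1), A (3 * p + 2))) {..<M} (set Q)"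
proof -
  have "bij_betw ((!) Q \<circ> (\<lambda>p. (p + s) mod M)) {..<M} (set Q)"
    using assms(1,2) by (intro bij_betw_trans[OF bij_betw_add_mod] bij_betw_nth) auto
  moreover have "(A (3 * p), A (3 * p + 1), A (3 * p + 2)) = ((!) Q \<circ> (\<lambda>p. (p + s) mod M)) p"
    if "p \<in> {..<M}" for p
  proof -
    have "(p + s) mod M < length Q"
      using that assms(2) by simp
    moreover have "(3 * p + 3 * s) mod (3 * M) = 3 * ((p + s) mod M)"
      using mod_path[of 0 p s M] by simp
    ultimately show ?thesis
      using that A mod_path[of 1 p s M] mod_path[of 2 p s M] by (simp add: nth_flatten)
  qed
  ultimately show ?thesis
    using bij_betw_cong[of "{..<M}" "\<lambda>p. (A (3 * p), A (3 * p + 1), A (3 * p + 2))"] by blast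
qed

section \<open>Decoding of input and output\<close>

lemma encode_paths_eq:
  "encode_paths n team Q i =
     (if i < length (flatten Q) then the_inv_into {..<2 * n} team (flatten Q ! i) else 0)"
  by (simp add: encode_paths_def flatten_def)

lemma bij_betw_team:
  assumes "team_numbering n X Y team" "X \<inter> Y = {}"
  shows "bij_betw team {..<2 * n} (X \<union> Y)"
proof -
  have "bij_betw team ({..<n} \<union> {n..<2 * n}) (X \<union> Y)"
    using assms by (intro bij_betw_combine) (auto simp: team_numbering_def)
  moreover have "{..<n} \<union> {n..<2 * n} = {..<2 * n}"
    by auto
  ultimately show ?thesis
    by simp
qed

lemma encode_paths:
  assumes team: "team_numbering n X Y team" "X \<inter> Y = {}"
    and V: "three_path_packing V (set Q)" "distinct Q" "V \<subseteq> X \<union> Y"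
  shows "i < length (flatten Q) \<Longrightarrow> team (encode_paths n team Q i) = flatten Q ! i"
    and "inj_on (encode_paths n team Q) {..<length (flatten Q)}"
    and "V \<subseteq> X \<Longrightarrow> encode_paths n team Q ` {..<length (flatten Q)} \<subseteq> {..<n}"
    and "V \<subseteq> Y \<Longrightarrow> encode_paths n team Q ` {..<length (flatten Q)} \<subseteq> {n..<2 * n}"
proof -
  note bij = bij_betw_team[OF team]
  have in_V: "flatten Q ! i \<in> V" if "i < length (flatten Q)" for i
    using that set_flatten[OF V(1)] nth_mem by blast
  show team_eq: "team (encode_paths n team Q i) = flatten Q ! i" if "i < length (flatten Q)" for i
    using that in_V[OF that] V(3) f_the_inv_into_f_bij_betw[OF bij] by (auto simp: encode_paths_eq)
  show "inj_on (encode_paths n team Q) {..<length (flatten Q)}"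
    using team_eq distinct_flatten[OF V(1,2)]
    by (intro inj_onI) (metis lessThan_iff nth_eq_iff_index_eq)
  have less: "encode_paths n team Q i < 2 * n" if "i < length (flatten Q)" for i
    using that in_V[OF that] V(3) bij_betw_the_inv_into[OF bij]
    by (force simp: encode_paths_eq bij_betw_def)
  have X: "team v \<in> X" if "v < n" for v
    using team(1) that by (auto simp: team_numbering_def bij_betw_def)
  have Y: "team v \<in> Y" if "n \<le> v" "v < 2 * n" for v
    using team(1) that by (auto simp: team_numbering_def bij_betw_def)
  show "encode_paths n team Q ` {..<length (flatten Q)} \<subseteq> {..<n}" if "V \<subseteq> X"
  proof (clarsimp)
    fix i assume i: "i < length (flatten Q)"
    then have "team (encode_paths n team Q i) \<in> X"
      using in_V team_eq that by auto
    then show "encode_paths n team Q i < n"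
      using Y[of "encode_paths n team Q i"] less[OF i] team(2) by (meson disjoint_iff not_le)
  qed
  show "encode_paths n team Q ` {..<length (flatten Q)} \<subseteq> {n..<2 * n}" if "V \<subseteq> Y"
  proof (clarsimp)
    fix i assume i: "i < length (flatten Q)"
    then have "team (encode_paths n team Q i) \<in> Y"
      using in_V team_eq that by auto
    then show "n \<le> encode_paths n team Q i \<and> encode_paths n team Q i < 2 * n"
      using X[of "encode_paths n team Q i"] less[OF i] team(2) by (meson disjoint_iff not_le)
  qed
qed

lemma output_schedule_eq:
  fixes n M and team :: "nat \<Rightarrow> 'a"
  assumes "grouping n (group_count n M) (group_of n M)"
    and "scheduler_input.written n px py \<sigma> M (2 * (n * n)) s" "scheduler_input d n px py \<sigma> M"
    and t: "t < 2 * n"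
  shows "output_schedule n team s t
    = grouping.cyclic_schedule n (group_count n M) (group_of n M) 0
        (team \<circ> ints s ''ax'') (team \<circ> ints s ''ay'') t"
proof -
  interpret grouping n "group_count n M" "group_of n M" by fact
  interpret scheduler_input d n px py \<sigma> M by fact
  have cell: "(team (ints s ''home'' (t * n + k)), team (ints s ''away'' (t * n + k)))
      = game 0 (team \<circ> ints s ''ax'') (team \<circ> ints s ''ay'') t k" if "k < n" for k
  proof -
    have "t * n + k < Suc t * n"
      using that by simp
    also have "\<dots> \<le> 2 * n * n"
      using t by (intro mult_le_mono1) simp
    finally have "t * n + k < 2 * (n * n)"
      by (simp add: mult.assoc)
    moreover have "(t * n + k) div n = t" "(t * n + k) mod n = k"
      using that by simp_all
    ultimately have "ints s ''home'' (t * n + k) = home_team s t k"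
      "ints s ''away'' (t * n + k) = away_team s t k"
      using assms(2) by (simp_all add: written_def)
    \<comment> \<open>\<open>side\<close> spells out the parity of the rank; the program realises
      the schedule with bit \<open>b = 0\<close>.\<close>
    moreover have "side n M t k = rank t k mod 2"
      by (simp add: side_def rank_def level_def)
    ultimately show ?thesis
      by (simp add: home_team_def away_team_def game_def opp_def even_iff_mod_2_eq_zero)
  qed
  show ?thesis
    using cell unfolding output_schedule_def cyclic_schedule_def by (auto simp: image_iff) metis+
qed

text \<open>Expresses \<open>path_day_weight\<close> through the input lists, so that the shift is
  explicit and can be averaged over.\<close>

definition shifted_day_weight ::
  "('a \<Rightarrow> 'a \<Rightarrow> real) \<Rightarrow> nat \<Rightarrow> nat \<Rightarrow> 'a list \<Rightarrow> 'a list \<Rightarrow> nat \<Rightarrow> nat \<Rightarrow> real" where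
  "shifted_day_weight w n M us vs \<sigma> t =
     (\<Sum>i<n. if i < 3 * M \<and> grouping.opp n t i < 3 * M
        then w (us ! ((i + 3 * \<sigma>) mod (3 * M))) (vs ! grouping.opp n t i) else 0)"

lemma schedule_of_scheduler:
  fixes n M \<sigma> :: nat and X Y :: "'a set" and w :: "'a \<Rightarrow> 'a \<Rightarrow> real"
    and PX PY :: "('a \<times> 'a \<times> 'a) list"
  defines "meeting \<equiv> shifted_day_weight w n M (flatten PX) (flatten PY) \<sigma>"
  assumes inst: "bttp_instance n X Y w" and M: "0 < M" "3 * M + 3 \<le> n" "M = path_count d n"
    and \<sigma>: "\<sigma> < M"
    and U: "U \<subseteq> X" "card U = 3 * M" and V: "V \<subseteq> Y" "card V = 3 * M"
    and PX: "three_path_packing U (set PX)" "distinct PX"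
    and PY: "three_path_packing V (set PY)" "distinct PY"
    and team: "team_numbering n X Y team"
    and s: "scheduler_input.written n (encode_paths n team PX) (encode_paths n team PY) \<sigma> M
      (2 * (n * n)) s"
  shows "feasible n X Y (output_schedule n team s)"
    and "schedule_weight n X Y w (output_schedule n team s)
      \<le> delta_packing w V (set PX) + real (3 * M) * packing_weight w (set PX)
        + delta_packing w U (set PY) + real (3 * M) * packing_weight w (set PY)
        + 8 * low_weight w X Y U V + 2 * meeting 0 + 2 * meeting (2 * n - 1)"
proof -
  define px py where "px = encode_paths n team PX" and "py = encode_paths n team PY"
  have disj: "X \<inter> Y = {}"
    using inst by (simp add: bttp_instance_def)
  have len: "length PX = M" "length PY = M"
    using distinct_card[OF distinct_flatten[OF PX]] distinct_card[OF distinct_flatten[OF PY]]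
      set_flatten[OF PX(1)] set_flatten[OF PY(1)] U V by (simp_all add: length_flatten)
  note px_enc = encode_paths[OF team disj PX le_supI1[OF U(1)], folded px_def, unfolded length_flatten len]
  note py_enc = encode_paths[OF team disj PY le_supI2[OF V(1)], folded py_def, unfolded length_flatten len]
  have input: "scheduler_input d n px py \<sigma> M"
    using M \<sigma> px_enc py_enc U V by unfold_locales auto
  interpret scheduler_input d n px py \<sigma> M
    by (rule input)
  have grouping: "grouping n (group_count n M) (group_of n M)"
    using M by (intro grouping_group_of)
  define A B where "A = team \<circ> ints s ''ax''" and "B = team \<circ> ints s ''ay''"
  have seeded: "seeded s"
    using s[folded px_def py_def] by (simp add: written_def)
  have "bij_betw A {..<n} X" "bij_betw B {..<n} Y"
    using seeded team unfolding A_def B_def seeded_def team_numbering_def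
    by (auto intro: bij_betw_trans)
  then interpret path_seeding n "group_count n M" "group_of n M" X Y A B 0 w M
    using grouping disj inst M group_of_path
    by (intro path_seeding.intro seeding.intro seeding_axioms.intro path_seeding_axioms.intro) auto
  have A: "A i = flatten PX ! ((i + 3 * \<sigma>) mod (3 * M))" if "i < 3 * M" for i
    using that seeded px_enc(1)[OF shift_less, of i] by (simp add: A_def seeded_def qx_def)
  have B: "B i = flatten PY ! i" if "i < 3 * M" for i
    using that seeded py_enc(1) by (simp add: B_def seeded_def)
  have out: "output_schedule n team s t = S t" if "t < 2 * n" for t
    using output_schedule_eq[OF grouping _ input that] s by (simp add: A_def B_def px_def py_def)
  show "feasible n X Y (output_schedule n team s)"
    by (rule feasible_cong[OF out feasible_cyclic_schedule])
  have QX: "bij_betw (\<lambda>p. (A (3 * p), A (3 * p + 1), A (3 * p + 2))) {..<M} (set PX)"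
    using PX(2) len(1) A by (rule bij_betw_shifted_paths)
  have QY: "bij_betw (\<lambda>p. (B (3 * p), B (3 * p + 1), B (3 * p + 2))) {..<M} (set PY)"
    by (rule bij_betw_shifted_paths[OF PY(2) len(2), of B 0]) (simp add: B)
  \<comment> \<open>The rotation permutes the path positions, hence the set of teams on them does
    not depend on the shift.\<close>
  have "A ` {..<3 * M} = (!) (flatten PX) ` {..<3 * M}"
  proof -
    have "A ` {..<3 * M} = (!) (flatten PX) ` (\<lambda>i. (i + 3 * \<sigma>) mod (3 * M)) ` {..<3 * M}"
      unfolding image_image using A by (intro image_cong) auto
    then show ?thesis
      using bij_betw_add_mod[of "3 * \<sigma>" "3 * M"] by (simp add: bij_betw_def)
  qed
  then have AU: "A ` {..<3 * M} = U"
    using bij_betw_nth[OF distinct_flatten[OF PX] refl refl] set_flatten[OF PX(1)] len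
    by (simp add: length_flatten bij_betw_def)
  have "B ` {..<3 * M} = (!) (flatten PY) ` {..<3 * M}"
    using B by (intro image_cong) auto
  then have BV: "B ` {..<3 * M} = V"
    using bij_betw_nth[OF distinct_flatten[OF PY] refl refl] set_flatten[OF PY(1)] len
    by (simp add: length_flatten bij_betw_def)
  have "path_day_weight t = meeting t" for t
    unfolding path_day_weight_def meeting_def shifted_day_weight_def using A B by (intro sum.cong) auto
  moreover have "schedule_weight n X Y w (output_schedule n team s) = schedule_weight n X Y w S"
    using out n_pos by (rule schedule_weight_cong)
  ultimately show "schedule_weight n X Y w (output_schedule n team s)
      \<le> delta_packing w V (set PX) + real (3 * M) * packing_weight w (set PX)
        + delta_packing w U (set PY) + real (3 * M) * packing_weight w (set PY)
        + 8 * low_weight w X Y U V + 2 * meeting 0 + 2 * meeting (2 * n - 1)"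
    using schedule_weight_le[OF QX QY] by (simp add: AU BV)
qed

section \<open>Error terms and the choice of parameters\<close>

lemma sum_path_pairs_le:
  assumes inst: "bttp_instance n X Y w" and "U \<subseteq> X" "V \<subseteq> Y"
    and us: "distinct us" "set us = U" and vs: "distinct vs" "set vs = V"
  shows "(\<Sum>i<length us. \<Sum>j<length vs. w (us ! i) (vs ! j)) \<le> total_weight w X Y"
proof -
  have nonneg: "0 \<le> w x y" if "x \<in> X" "y \<in> Y" for x y
    using inst that by (auto simp: bttp_instance_def)
  have fin: "finite X" "finite Y"
    using inst by (auto simp: bttp_instance_def)
  have "(\<Sum>i<length us. \<Sum>j<length vs. w (us ! i) (vs ! j)) = (\<Sum>x\<in>U. \<Sum>y\<in>V. w x y)"
  proof -
    have "(\<Sum>j<length vs. w x (vs ! j)) = (\<Sum>y\<in>V. w x y)" for x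
      using sum.reindex_bij_betw[OF bij_betw_nth[OF vs(1) refl refl], of "w x"] by (simp add: vs)
    moreover have "(\<Sum>i<length us. \<Sum>y\<in>V. w (us ! i) y) = (\<Sum>x\<in>U. \<Sum>y\<in>V. w x y)"
      using sum.reindex_bij_betw[OF bij_betw_nth[OF us(1) refl refl], of "\<lambda>x. \<Sum>y\<in>V. w x y"]
      by (simp add: us)
    ultimately show ?thesis
      by simp
  qed
  also have "\<dots> \<le> (\<Sum>x\<in>U. \<Sum>y\<in>Y. w x y)"
    using assms nonneg fin by (intro sum_mono sum_mono2) auto
  also have "\<dots> \<le> (\<Sum>x\<in>X. \<Sum>y\<in>Y. w x y)"
    using assms nonneg fin by (intro sum_mono2) (auto intro!: sum_nonneg)
  finally show ?thesis
    by (simp add: total_weight_def delta_def)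
qed

text \<open>With \<open>q = n div (6 * d)\<close> one has \<open>M = 2 * d * q - d\<close>. So
  \<open>3 * d\<close> teams and the remainder of the division, which is below \<open>6 * d\<close>,
  lie off the paths.\<close>

lemma parameter_bounds:
  assumes "0 < \<epsilon>" "d = 6 * nat \<lceil>1 / \<epsilon>\<rceil>" "108 * d ^ 3 \<le> n" "M = path_count d n"
  shows "0 < d" "6 / real d \<le> \<epsilon>" "2 * d \<le> M" "3 * M + 3 \<le> n" "n - 3 * M \<le> 9 * d"
    "72 * (d * d) \<le> n"
proof -
  define c where "c = nat \<lceil>1 / \<epsilon>\<rceil>"
  have ceil: "1 / \<epsilon> \<le> real c" "0 < 1 / \<epsilon>"
    using assms(1) by (simp_all add: c_def real_nat_ceiling_ge)
  then have pos: "0 < real c"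
    by linarith
  then show d: "0 < d"
    using assms(2) by (simp add: c_def)
  have "1 \<le> \<epsilon> * real c"
    using ceil(1) assms(1) by (simp add: field_simps)
  then show "6 / real d \<le> \<epsilon>"
    using pos unfolding assms(2) c_def[symmetric] by (simp add: field_simps)
  have d3: "d * d \<le> d ^ 3"
    using d by (simp add: power3_eq_cube)
  then show "72 * (d * d) \<le> n"
    using assms(3) by linarith
  define q where "q = n div (6 * d)"
  have q: "n = 6 * d * q + n mod (6 * d)" "n mod (6 * d) < 6 * d"
    using d by (simp_all add: q_def)
  have "6 * d * 2 \<le> n"
  proof -
    have "d \<le> d * d"
      using d by simp
    then show ?thesis
      using d3 assms(3) by linarith
  qed
  then have q2: "2 \<le> q"
    using d by (simp add: q_def less_eq_div_iff_mult_less_eq mult.commute)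
  have M: "M + d = 2 * (d * q)"
  proof -
    have "M + d = (2 * q - 1 + 1) * d"
      using assms(4) by (simp add: path_count_def q_def)
    then show ?thesis
      using q2 by (simp add: algebra_simps)
  qed
  have "d * 2 \<le> d * q"
    using q2 by simp
  then show "2 * d \<le> M" "3 * M + 3 \<le> n" "n - 3 * M \<le> 9 * d"
    using M q d by (simp_all only: mult.assoc)
qed

text \<open>From \<open>n \<ge> 72 * d * d\<close> follows \<open>R \<le> T / (4 * d)\<close>, and
  with \<open>M \<ge> 2 * d\<close> both summands are at most \<open>2 * T / d\<close>. Their sum is
  bounded by \<open>6 / d\<close> times the lower bound \<open>2 / 3 * T\<close> for the
  optimum.\<close>

lemma error_le:
  fixes T R O \<epsilon> :: real and n M d :: nat
  assumes "0 < d" "6 / real d \<le> \<epsilon>" "2 * d \<le> M" "n - 3 * M \<le> 9 * d" "72 * (d * d) \<le> n"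
    and T: "0 \<le> T" "2 / 3 * T \<le> OPT'" and R: "real n * R \<le> 2 * real (n - 3 * M) * T"
  shows "8 * R + 4 * T / real M \<le> \<epsilon> * OPT'"
proof -
  have "0 < 72 * (d * d)"
    using assms(1) by simp
  then have "0 < n"
    using assms(5) by linarith
  then have n: "0 < real n" "72 * (real d * real d) \<le> real n"
    using of_nat_mono[OF assms(5), where 'a = real] by simp_all
  have "real n * R \<le> 2 * (9 * real d) * T"
    using R T(1) of_nat_mono[OF assms(4), where 'a = real]
    by (intro order_trans[OF R] mult_right_mono) auto
  then have "R \<le> 18 * real d * T / real n"
    using n by (simp add: field_simps)
  also have "\<dots> \<le> 18 * real d * T / (72 * (real d * real d))"
    using n T assms(1) by (intro divide_left_mono) auto
  also have "\<dots> = T / (4 * real d)"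
    using assms(1) by (simp add: field_simps)
  finally have "8 * R \<le> 2 * T / real d"
    by simp
  moreover have "4 * T / real M \<le> 4 * T / real (2 * d)"
    using assms T of_nat_mono[OF assms(3), where 'a = real] by (intro divide_left_mono) auto
  ultimately have "8 * R + 4 * T / real M \<le> 6 / real d * (2 / 3 * T)"
    using assms(1) by simp
  also have "\<dots> \<le> \<epsilon> * OPT'"
    using assms order_trans[of 0 "6 / real d" \<epsilon>] by (intro mult_mono) auto
  finally show ?thesis .
qed

theorem theorem3:
  fixes \<epsilon> :: real and d :: nat
  assumes "\<epsilon> > 0" and "d = 6 * nat \<lceil>1 / \<epsilon>\<rceil>"
  shows "\<exists>(prog :: com) (c :: nat) (k :: nat).
    \<forall>(n :: nat) (X :: 'a set) (Y :: 'a set) (w :: 'a \<Rightarrow> 'a \<Rightarrow> real) (m :: nat) (n\<^sub>\<epsilon> :: nat)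
      (X\<^sub>\<epsilon> :: 'a set) (Y\<^sub>\<epsilon> :: 'a set) (PX :: ('a \<times> 'a \<times> 'a) list) (PY :: ('a \<times> 'a \<times> 'a) list)
      (team :: nat \<Rightarrow> 'a).
      bttp_instance n X Y w \<and> n \<ge> 108 * d ^ 3 \<and>
      m = 2 * (n div (6 * d)) - 1 \<and> n\<^sub>\<epsilon> = 3 * m * d \<and>
      largest_teams n\<^sub>\<epsilon> w Y X X\<^sub>\<epsilon> \<and> largest_teams n\<^sub>\<epsilon> w X Y Y\<^sub>\<epsilon> \<and>
      three_path_packing X\<^sub>\<epsilon> (set PX) \<and> distinct PX \<and>
      three_path_packing Y\<^sub>\<epsilon> (set PY) \<and> distinct PY \<and>
      team_numbering n X Y team \<longrightarrow>
      (let result = run (n ^ k) (c * n ^ 2) prog (input_memory n w team PX PY) in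
        (\<forall>(c', s) \<in> set_pmf result.
           c' = Skip \<and> feasible n X Y (output_schedule n team s)) \<and>
        measure_pmf.expectation result
          (\<lambda>(c', s). schedule_weight n X Y w (output_schedule n team s))
        \<le> delta_packing w Y\<^sub>\<epsilon> (set PX) + real n\<^sub>\<epsilon> * packing_weight w (set PX)
          + delta_packing w X\<^sub>\<epsilon> (set PY) + real n\<^sub>\<epsilon> * packing_weight w (set PY)
          + \<epsilon> * OPT n X Y w)"
\<comment> \<open>67 is the time constant of \<open>run_scheduler\<close>; the exponent 3 makes room
  for \<open>2 * n * n\<close> output cells.\<close>
proof (rule exI[of _ "scheduler d"], rule exI[of _ 67], rule exI[of _ 3], intro allI impI, elim conjE)
  fix n :: nat and X Y :: "'a set" and w :: "'a \<Rightarrow> 'a \<Rightarrow> real" and m n\<^sub>\<epsilon> :: nat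
    and X\<^sub>\<epsilon> Y\<^sub>\<epsilon> :: "'a set" and PX PY :: "('a \<times> 'a \<times> 'a) list" and team :: "nat \<Rightarrow> 'a"
  assume inst: "bttp_instance n X Y w" and n: "n \<ge> 108 * d ^ 3"
    and m: "m = 2 * (n div (6 * d)) - 1" "n\<^sub>\<epsilon> = 3 * m * d"
    and X\<^sub>\<epsilon>: "largest_teams n\<^sub>\<epsilon> w Y X X\<^sub>\<epsilon>" and Y\<^sub>\<epsilon>: "largest_teams n\<^sub>\<epsilon> w X Y Y\<^sub>\<epsilon>"
    and PX: "three_path_packing X\<^sub>\<epsilon> (set PX)" "distinct PX"
    and PY: "three_path_packing Y\<^sub>\<epsilon> (set PY)" "distinct PY"
    and team: "team_numbering n X Y team"
  define M where "M = path_count d n"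
  have n\<^sub>\<epsilon>: "n\<^sub>\<epsilon> = 3 * M"
    using m by (simp add: M_def path_count_def)
  note bounds = parameter_bounds[OF assms n M_def]
  have M: "0 < M" "3 * M \<le> n" "3 \<le> n"
    using bounds by linarith+
  define px py where "px = encode_paths n team PX" and "py = encode_paths n team PY"
  define s\<^sub>0 where "s\<^sub>0 = input_memory n w team PX PY"
  have disj: "X \<inter> Y = {}"
    using inst by (simp add: bttp_instance_def)
  have U: "X\<^sub>\<epsilon> \<subseteq> X" "card X\<^sub>\<epsilon> = 3 * M" and V: "Y\<^sub>\<epsilon> \<subseteq> Y" "card Y\<^sub>\<epsilon> = 3 * M"
    using X\<^sub>\<epsilon> Y\<^sub>\<epsilon> n\<^sub>\<epsilon> by (auto simp: largest_teams_def)
  have len: "length (flatten PX) = 3 * M" "length (flatten PY) = 3 * M"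
    using distinct_card[OF distinct_flatten[OF PX]] distinct_card[OF distinct_flatten[OF PY]]
      set_flatten[OF PX(1)] set_flatten[OF PY(1)] U V by simp_all
  note px = encode_paths[OF team disj PX le_supI1[OF U(1)], folded px_def, unfolded len]
  note py = encode_paths[OF team disj PY le_supI2[OF V(1)], folded py_def, unfolded len]
  have px_facts: "inj_on px {..<3 * M}" "px ` {..<3 * M} \<subseteq> {..<n}"
    and py_facts: "inj_on py {..<3 * M}" "py ` {..<3 * M} \<subseteq> {n..<2 * n}"
    using px py U V by auto
  have s\<^sub>0: "ints s\<^sub>0 ''n'' 0 = n" "ints s\<^sub>0 ''px'' = px" "ints s\<^sub>0 ''py'' = py" "ints s\<^sub>0 ''mark'' = (\<lambda>_. 0)"
    by (simp_all add: s\<^sub>0_def input_memory_def px_def py_def)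
  obtain f where run: "run (n ^ 3) (67 * n\<^sup>2) (scheduler d) s\<^sub>0
      = map_pmf (\<lambda>\<sigma>. (Skip, f \<sigma>)) (pmf_of_set {..<M})"
    and written: "\<And>\<sigma>. \<sigma> < M \<Longrightarrow> scheduler_input.written n px py \<sigma> M (2 * (n * n)) (f \<sigma>)"
    using run_scheduler[OF M_def M px_facts py_facts s\<^sub>0] by blast
  interpret grouping n "group_count n M" "group_of n M"
    using bounds by (intro grouping_group_of)
  define meeting where "meeting = shifted_day_weight w n M (flatten PX) (flatten PY)"
  define ideal where "ideal = delta_packing w Y\<^sub>\<epsilon> (set PX) + real (3 * M) * packing_weight w (set PX)
    + delta_packing w X\<^sub>\<epsilon> (set PY) + real (3 * M) * packing_weight w (set PY)"
  define weight where "weight \<sigma> = schedule_weight n X Y w (output_schedule n team (f \<sigma>))" for \<sigma>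
  define R where "R = low_weight w X Y X\<^sub>\<epsilon> Y\<^sub>\<epsilon>"
  define T where "T = total_weight w X Y"
  have feas: "feasible n X Y (output_schedule n team (f \<sigma>))" if "\<sigma> < M" for \<sigma>
    using schedule_of_scheduler(1)[OF inst M(1) bounds(4) M_def that U V PX PY team] written[OF that]
    by (simp add: px_def py_def)
  have weight: "weight \<sigma> \<le> ideal + 8 * R + 2 * meeting \<sigma> 0 + 2 * meeting \<sigma> (2 * n - 1)"
    if "\<sigma> < M" for \<sigma>
    using schedule_of_scheduler(2)[OF inst M(1) bounds(4) M_def that U V PX PY team] written[OF that]
    by (simp add: px_def py_def weight_def ideal_def R_def meeting_def)
  have "(\<Sum>i<3 * M. \<Sum>j<3 * M. w (flatten PX ! i) (flatten PY ! j)) \<le> T"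
    using sum_path_pairs_le[OF inst U(1) V(1) distinct_flatten[OF PX] set_flatten[OF PX(1)]
        distinct_flatten[OF PY] set_flatten[OF PY(1)]] by (simp add: len T_def)
  moreover have "0 \<le> w (flatten PX ! i) (flatten PY ! j)" if "i < 3 * M" "j < 3 * M" for i j
  proof -
    have "flatten PX ! i \<in> X" "flatten PY ! j \<in> Y"
      using that len nth_mem[of i "flatten PX"] nth_mem[of j "flatten PY"]
        set_flatten[OF PX(1)] set_flatten[OF PY(1)] U V by auto
    then show ?thesis
      using inst by (simp add: bttp_instance_def)
  qed
  \<comment> \<open>For a fixed day all shifts together count each pair at most once, so the average
    over the shifts is at most \<open>T / M\<close>.\<close>
  ultimately have meeting: "(\<Sum>\<sigma><M. meeting \<sigma> t) \<le> T" for t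
    using sum_shifted_day_le[of M "\<lambda>i j. w (flatten PX ! i) (flatten PY ! j)" t] M
    by (simp add: meeting_def shifted_day_weight_def)
  have "(\<Sum>\<sigma><M. weight \<sigma>)
      \<le> (\<Sum>\<sigma><M. ideal + 8 * R + 2 * meeting \<sigma> 0 + 2 * meeting \<sigma> (2 * n - 1))"
    using weight by (intro sum_mono) simp
  also have "\<dots> = real M * (ideal + 8 * R) + 2 * (\<Sum>\<sigma><M. meeting \<sigma> 0)
      + 2 * (\<Sum>\<sigma><M. meeting \<sigma> (2 * n - 1))"
    by (simp add: sum.distrib sum_distrib_left)
  also have "\<dots> \<le> real M * (ideal + 8 * R) + 4 * T"
    using meeting[of 0] meeting[of "2 * n - 1"] by simp
  finally have "(\<Sum>\<sigma><M. weight \<sigma>) / real M \<le> ideal + (8 * R + 4 * T / real M)"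
    using M by (simp add: field_simps)
  also have "8 * R + 4 * T / real M \<le> \<epsilon> * OPT n X Y w"
  proof (rule error_le)
    \<comment> \<open>The shift 0 provides the feasible schedule that the lower bound asks
      for.\<close>
    show "2 / 3 * T \<le> OPT n X Y w"
      unfolding T_def using inst M feas[of 0] by (intro total_weight_le_OPT) auto
    show "0 \<le> T"
      unfolding T_def using inst by (rule total_weight_nonneg)
    show "real n * R \<le> 2 * real (n - 3 * M) * T"
      using low_weight_le[OF inst X\<^sub>\<epsilon> Y\<^sub>\<epsilon>] by (simp add: R_def T_def n\<^sub>\<epsilon>)
  qed (use bounds in auto)
  finally have expectation: "(\<Sum>\<sigma><M. weight \<sigma>) / real M \<le> ideal + \<epsilon> * OPT n X Y w"
    by simp
  have ne: "{..<M} \<noteq> {}"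
    using M by auto
  show "let result = run (n ^ 3) (67 * n ^ 2) (scheduler d) (input_memory n w team PX PY) in
        (\<forall>(c', s) \<in> set_pmf result.
           c' = Skip \<and> feasible n X Y (output_schedule n team s)) \<and>
        measure_pmf.expectation result
          (\<lambda>(c', s). schedule_weight n X Y w (output_schedule n team s))
        \<le> delta_packing w Y\<^sub>\<epsilon> (set PX) + real n\<^sub>\<epsilon> * packing_weight w (set PX)
          + delta_packing w X\<^sub>\<epsilon> (set PY) + real n\<^sub>\<epsilon> * packing_weight w (set PY)
          + \<epsilon> * OPT n X Y w"
    unfolding Let_def s\<^sub>0_def[symmetric] run n\<^sub>\<epsilon>
    using feas expectation ne
    by (simp add: set_pmf_of_set integral_pmf_of_set weight_def ideal_def)
qed

end
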